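(* Let $t\geq 1$, let $r_1,\ldots,r_t$ be positive integers with $\gcd(r_i,r_j)=1$ for all $i\neq j$, and let $C_i=\langle x_i\mid x_i^{r_i}\rangle\cong\mathbb{Z}_{r_i}$ for $1\leq i\leq t$. Then for all $c\geq 1$, $$M^{(c)}\Big(C_1*C_2*\cdots*C_t\Big)\cong\bigoplus_{i=1}^{t}M^{(c)}(C_i)=1,$$ where $C_1*\cdots*C_t$ is the free product of the $C_i$.
   Context: For a group $G$ with a free presentation $1\to R\to F\to G\to 1$ ($F$ free, $R\trianglelefteq F$), and an integer $c\geq 1$, the $c$-nilpotent multiplier of $G$ (the Baer-invariant of $G$ with respect to the variety of nilpotent groups of class at most $c$) is $M^{(c)}(G)=\dfrac{R\cap \gamma_{c+1}(F)}{[R,\,_cF]}$, where $\gamma_{k}(F)$ is the $k$-th term of the lower central series of $F$ ($\gamma_1(F)=F$, $\gamma_{k+1}(F)=[\gamma_k(F),F]$), $[R,\,_1F]=[R,F]$ and $[R,\,_cF]=[[R,\,_{c-1}F],F]$. This group is abelian and, up to isomorphism, independent of the chosen free presentation. *)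

theory Defs
  imports "HOL-Algebra.Algebra"
begin

fun word_eval :: "('a, 'b) monoid_scheme \<Rightarrow> (bool \<times> 'a) list \<Rightarrow> 'a" where
  "word_eval G [] = \<one>\<^bsub>G\<^esub>"
| "word_eval G ((True, x) # w) = x \<otimes>\<^bsub>G\<^esub> word_eval G w"
| "word_eval G ((False, x) # w) = inv\<^bsub>G\<^esub> x \<otimes>\<^bsub>G\<^esub> word_eval G w"

fun reduced_word :: "(bool \<times> 'a) list \<Rightarrow> bool" where
  "reduced_word [] = True"
| "reduced_word [_] = True"
| "reduced_word ((b, x) # (b', y) # w) =
     (\<not> (x = y \<and> b \<noteq> b') \<and> reduced_word ((b', y) # w))"

definition free_basis :: "('a, 'b) monoid_scheme \<Rightarrow> 'a set \<Rightarrow> bool" where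
  "free_basis F B \<longleftrightarrow> group F \<and> B \<subseteq> carrier F \<and> generate F B = carrier F \<and>
     (\<forall>w. w \<noteq> [] \<and> reduced_word w \<and> snd ` set w \<subseteq> B \<longrightarrow> word_eval F w \<noteq> one F)"

definition free_group :: "('a, 'b) monoid_scheme \<Rightarrow> bool" where
  "free_group F \<longleftrightarrow> (\<exists>B. free_basis F B)"

definition comm_subgroup :: "('a, 'b) monoid_scheme \<Rightarrow> 'a set \<Rightarrow> 'a set \<Rightarrow> 'a set" where
  "comm_subgroup G H K = generate G
     {h \<otimes>\<^bsub>G\<^esub> k \<otimes>\<^bsub>G\<^esub> inv\<^bsub>G\<^esub> h \<otimes>\<^bsub>G\<^esub> inv\<^bsub>G\<^esub> k | h k. h \<in> H \<and> k \<in> K}"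

text \<open>gamma G k is the k-th term of the lower central series for k >= 1
 (gamma G 1 = G, gamma G (k+1) = [gamma G k, G]); gamma G 0 is a junk value.\<close>
fun gamma :: "('a, 'b) monoid_scheme \<Rightarrow> nat \<Rightarrow> 'a set" where
  "gamma G 0 = carrier G"
| "gamma G (Suc n) = (if n = 0 then carrier G else comm_subgroup G (gamma G n) (carrier G))"

fun iter_comm :: "('a, 'b) monoid_scheme \<Rightarrow> 'a set \<Rightarrow> nat \<Rightarrow> 'a set" where
  "iter_comm G R 0 = R"
| "iter_comm G R (Suc c) = comm_subgroup G (iter_comm G R c) (carrier G)"

definition normal_closure :: "('a, 'b) monoid_scheme \<Rightarrow> 'a set \<Rightarrow> 'a set" where
  "normal_closure G S = generate G (\<Union>g \<in> carrier G. (\<lambda>s. g \<otimes>\<^bsub>G\<^esub> s \<otimes>\<^bsub>G\<^esub> inv\<^bsub>G\<^esub> g) ` S)"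

text \<open>For a free presentation 1 -> R -> F -> G -> 1:
 M^(c)(G) = (R \<inter> gamma_{c+1}(F)) / [R, _c F].\<close>
definition nilpotent_multiplier ::
  "('a, 'b) monoid_scheme \<Rightarrow> 'a set \<Rightarrow> nat \<Rightarrow> 'a set monoid" where
  "nilpotent_multiplier F R c =
     (F\<lparr>carrier := R \<inter> gamma F (Suc c)\<rparr>) Mod (iter_comm F R c)"

end

theory Submission
  imports Defs "HOL-Number_Theory.Cong"
begin

text \<open>
  Let \<open>R\<close> be the kernel of \<open>F \<rightarrow> G\<close>. By induction on \<open>c\<close> one may pass to \<open>E = F/[R,\<^sub>cF]\<close> with \<open>K\<close> the image
  of \<open>R\<close>: then \<open>K\<close> is hypercentral in \<open>E\<close> and, by the induction hypothesis, \<open>A = K \<inter> \<gamma>\<^sub>c\<^sub>+\<^sub>1(E)\<close> is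
  central; the claim is \<open>A = 1\<close>. Lifts \<open>e\<^sub>i\<close> of the generators of \<open>G\<close> have \<open>e\<^sub>i\<close> to the power \<open>r\<^sub>i\<close> in \<open>K\<close>,
  so coprimality forces \<open>\<gamma>\<^sub>2(E) = [K,E] \<gamma>\<^sub>3(E)\<close>. Consequently \<open>L = \<gamma>\<^sub>c\<^sub>+\<^sub>1(E)\<close> satisfies \<open>L = [L,E]\<close>, it
  commutes with \<open>K\<close>, and \<open>E/KL\<close> is cyclic by the Chinese remainder theorem. Hence the lifts can be
  chosen to be powers of one element modulo \<open>L\<close>, and coprimality shows once more that their
  \<open>r\<^sub>i\<close>-th powers commute with all the lifts. Now the argument for the Schur multiplier applies: an
  element of \<open>A\<close> is the image of a word in the derived subgroup of the free group \<open>F0\<close> that is a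
  product of conjugates of relators, so all its exponent sums vanish, and its image is the
  product of the central \<open>r\<^sub>i\<close>-th powers with exponents zero.
\<close>

section \<open>Commutator subgroups\<close>

context group
begin

lemma l_cancel_inv [simp]:
  "\<lbrakk>a \<in> carrier G; b \<in> carrier G\<rbrakk> \<Longrightarrow> a \<otimes> (inv a \<otimes> b) = b"
  "\<lbrakk>a \<in> carrier G; b \<in> carrier G\<rbrakk> \<Longrightarrow> inv a \<otimes> (a \<otimes> b) = b"
  by (simp_all flip: m_assoc)

lemma inv_commute:
  assumes "a \<in> carrier G" "b \<in> carrier G" "a \<otimes> b = b \<otimes> a"
  shows "inv a \<otimes> b = b \<otimes> inv a"
proof -
  have "inv a \<otimes> b = inv a \<otimes> (b \<otimes> a) \<otimes> inv a" using assms(1,2) by (simp add: m_assoc)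
  also have "\<dots> = b \<otimes> inv a" using assms(1,2) by (simp flip: assms(3))
  finally show ?thesis .
qed

lemma comm_subgroup_incl:
  assumes "subgroup N G" "\<And>h k. h \<in> H \<Longrightarrow> k \<in> K \<Longrightarrow> h \<otimes> k \<otimes> inv h \<otimes> inv k \<in> N"
  shows "comm_subgroup G H K \<subseteq> N"
  unfolding comm_subgroup_def by (rule generate_subgroup_incl) (use assms in auto)

lemma commutator_in_comm_subgroup:
  "h \<in> H \<Longrightarrow> k \<in> K \<Longrightarrow> h \<otimes> k \<otimes> inv h \<otimes> inv k \<in> comm_subgroup G H K"
  unfolding comm_subgroup_def by (rule generate.incl) auto

lemma comm_subgroup_mono:
  "H \<subseteq> H' \<Longrightarrow> K \<subseteq> K' \<Longrightarrow> comm_subgroup G H K \<subseteq> comm_subgroup G H' K'"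
  unfolding comm_subgroup_def by (rule mono_generate) auto

lemma comm_subgroup_normal:
  assumes "H \<lhd> G"
  shows "comm_subgroup G H (carrier G) \<lhd> G"
proof -
  interpret H: normal H G by fact
  show ?thesis
    unfolding comm_subgroup_def
  proof (rule normal_generateI)
    show "{h \<otimes> k \<otimes> inv h \<otimes> inv k | h k. h \<in> H \<and> k \<in> carrier G} \<subseteq> carrier G"
      by auto
  next
    fix u g assume u: "u \<in> {h \<otimes> k \<otimes> inv h \<otimes> inv k | h k. h \<in> H \<and> k \<in> carrier G}"
      and g: "g \<in> carrier G"
    then obtain h k where hk: "u = h \<otimes> k \<otimes> inv h \<otimes> inv k" "h \<in> H" "k \<in> carrier G" by blast
    have "g \<otimes> u \<otimes> inv g = (g \<otimes> h \<otimes> inv g) \<otimes> (g \<otimes> k \<otimes> inv g)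
        \<otimes> inv (g \<otimes> h \<otimes> inv g) \<otimes> inv (g \<otimes> k \<otimes> inv g)"
      using hk g by (simp add: m_assoc inv_mult_group)
    moreover have "g \<otimes> h \<otimes> inv g \<in> H" using hk g by (simp add: H.inv_op_closed2)
    ultimately show "g \<otimes> u \<otimes> inv g \<in> {h \<otimes> k \<otimes> inv h \<otimes> inv k | h k. h \<in> H \<and> k \<in> carrier G}"
      using hk g by blast
  qed
qed

lemma comm_subgroup_subset:
  assumes "H \<lhd> G"
  shows "comm_subgroup G H (carrier G) \<subseteq> H"
proof -
  interpret H: normal H G by fact
  show ?thesis
  proof (rule comm_subgroup_incl)
    show "subgroup H G" by (rule H.subgroup_axioms)
    fix h k assume h: "h \<in> H" "k \<in> carrier G"
    then have "h \<otimes> (k \<otimes> inv h \<otimes> inv k) \<in> H" by (simp add: H.inv_op_closed2)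
    then show "h \<otimes> k \<otimes> inv h \<otimes> inv k \<in> H" using h by (simp add: m_assoc)
  qed
qed

lemma carrier_normal: "carrier G \<lhd> G"
  by (simp add: normal_inv_iff subgroup_self)

lemma iter_comm_normal: "H \<lhd> G \<Longrightarrow> iter_comm G H n \<lhd> G"
  by (induction n) (auto intro: comm_subgroup_normal)

lemma iter_comm_Suc_subset: "H \<lhd> G \<Longrightarrow> iter_comm G H (Suc n) \<subseteq> iter_comm G H n"
  by (simp add: comm_subgroup_subset iter_comm_normal)

lemma iter_comm_subset: "H \<lhd> G \<Longrightarrow> iter_comm G H n \<subseteq> H"
  by (induction n) (simp, metis iter_comm_Suc_subset order_trans)

lemma iter_comm_mono: "H \<subseteq> H' \<Longrightarrow> iter_comm G H n \<subseteq> iter_comm G H' n"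
  by (induction n) (simp_all add: comm_subgroup_mono)

text \<open>One operator \<open>iter_comm\<close> serves both for the lower central series and for
  the series starting at a normal subgroup. The index drops by one:
  \<open>iter_comm G (carrier G) n\<close> is the term called gamma_(n+1) in the comments
  below.\<close>

lemma gamma_Suc_eq_iter_comm: "gamma G (Suc n) = iter_comm G (carrier G) n"
  by (induction n) auto

lemma set_mult_normal:
  assumes "H \<lhd> G" "K \<lhd> G"
  shows "H <#> K \<lhd> G"
proof -
  interpret H: normal H G by fact
  interpret K: normal K G by fact
  have sub: "subgroup (H <#> K) G"
    by (rule second_isomorphism_grp.normal_set_mult_subgroup)
      (simp add: second_isomorphism_grp_def second_isomorphism_grp_axioms_def assms(1) K.subgroup_axioms)
  show ?thesis
  proof (rule normal_invI[OF sub])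
    fix g u assume g: "g \<in> carrier G" and "u \<in> H <#> K"
    then obtain h k where hk: "u = h \<otimes> k" "h \<in> H" "k \<in> K" by (auto simp: set_mult_def)
    then have "g \<otimes> u \<otimes> inv g = (g \<otimes> h \<otimes> inv g) \<otimes> (g \<otimes> k \<otimes> inv g)"
      using g by (simp add: m_assoc)
    moreover have "g \<otimes> h \<otimes> inv g \<in> H" "g \<otimes> k \<otimes> inv g \<in> K"
      using hk g by (simp_all add: H.inv_op_closed2 K.inv_op_closed2)
    ultimately show "g \<otimes> u \<otimes> inv g \<in> H <#> K" by (auto simp: set_mult_def)
  qed
qed

lemma set_mult_supset:
  assumes "subgroup H G" "subgroup K G"
  shows "H \<subseteq> H <#> K" "K \<subseteq> H <#> K"
proof -
  show "H \<subseteq> H <#> K"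
    using assms subgroup.one_closed[OF assms(2)] subgroup.mem_carrier[OF assms(1)]
    by (force simp: set_mult_def)
  show "K \<subseteq> H <#> K"
    using assms subgroup.one_closed[OF assms(1)] subgroup.mem_carrier[OF assms(2)]
    by (force simp: set_mult_def)
qed

text \<open>With [u,g] = u g u^-1 g^-1, the identity [hk,g] = h[k,g]h^-1 [h,g] splits every
  generating commutator; the first factor stays in [K,G] because that subgroup is normal.\<close>

lemma comm_subgroup_set_mult:
  assumes "H \<lhd> G" "K \<lhd> G"
  shows "comm_subgroup G (H <#> K) (carrier G)
    \<subseteq> comm_subgroup G H (carrier G) <#> comm_subgroup G K (carrier G)"
proof -
  interpret H: normal H G by fact
  interpret K: normal K G by fact
  interpret CH: normal "comm_subgroup G H (carrier G)" G using assms by (simp add: comm_subgroup_normal)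
  interpret CK: normal "comm_subgroup G K (carrier G)" G using assms by (simp add: comm_subgroup_normal)
  interpret HK: normal "comm_subgroup G H (carrier G) <#> comm_subgroup G K (carrier G)" G
    by (intro set_mult_normal CH.normal_axioms CK.normal_axioms)
  show ?thesis
  proof (rule comm_subgroup_incl[OF HK.subgroup_axioms])
    fix u g assume "u \<in> H <#> K" and g: "g \<in> carrier G"
    then obtain h k where hk: "u = h \<otimes> k" "h \<in> H" "k \<in> K" by (auto simp: set_mult_def)
    have "u \<otimes> g \<otimes> inv u \<otimes> inv g
        = (h \<otimes> (k \<otimes> g \<otimes> inv k \<otimes> inv g) \<otimes> inv h) \<otimes> (h \<otimes> g \<otimes> inv h \<otimes> inv g)"
      using hk g by (simp add: m_assoc inv_mult_group)
    moreover have "h \<otimes> (k \<otimes> g \<otimes> inv k \<otimes> inv g) \<otimes> inv h \<in> comm_subgroup G K (carrier G)"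
      using hk g by (intro CK.inv_op_closed2 commutator_in_comm_subgroup) auto
    moreover have "h \<otimes> g \<otimes> inv h \<otimes> inv g \<in> comm_subgroup G H (carrier G)"
      using hk g by (intro commutator_in_comm_subgroup) auto
    ultimately show "u \<otimes> g \<otimes> inv u \<otimes> inv g
        \<in> comm_subgroup G H (carrier G) <#> comm_subgroup G K (carrier G)"
      using set_mult_supset[OF CH.subgroup_axioms CK.subgroup_axioms] HK.m_closed by (simp add: subset_iff)
  qed
qed

section \<open>Centralizers and commuting powers\<close>

lemma subgroup_centralizer:
  assumes "S \<subseteq> carrier G"
  shows "subgroup {g \<in> carrier G. \<forall>s\<in>S. g \<otimes> s = s \<otimes> g} G"
proof (rule subgroupI)
  fix a assume a: "a \<in> {g \<in> carrier G. \<forall>s\<in>S. g \<otimes> s = s \<otimes> g}"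
  have "inv a \<otimes> s = s \<otimes> inv a" if "s \<in> S" for s
    using a that assms by (intro inv_commute) auto
  then show "inv a \<in> {g \<in> carrier G. \<forall>s\<in>S. g \<otimes> s = s \<otimes> g}" using a by simp
next
  fix a b assume ab: "a \<in> {g \<in> carrier G. \<forall>s\<in>S. g \<otimes> s = s \<otimes> g}"
    "b \<in> {g \<in> carrier G. \<forall>s\<in>S. g \<otimes> s = s \<otimes> g}"
  have "a \<otimes> b \<otimes> s = s \<otimes> (a \<otimes> b)" if "s \<in> S" for s
  proof -
    have s: "s \<in> carrier G" "a \<in> carrier G" "b \<in> carrier G" "a \<otimes> s = s \<otimes> a" "b \<otimes> s = s \<otimes> b"
      using ab that assms by auto
    then have "a \<otimes> b \<otimes> s = a \<otimes> (b \<otimes> s)" by (simp only: m_assoc)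
    also have "\<dots> = a \<otimes> s \<otimes> b" using s(1-3) unfolding s(5) by (simp add: m_assoc)
    also have "\<dots> = s \<otimes> a \<otimes> b" by (simp only: s(4))
    also have "\<dots> = s \<otimes> (a \<otimes> b)" using s by (simp add: m_assoc)
    finally show ?thesis .
  qed
  then show "a \<otimes> b \<in> {g \<in> carrier G. \<forall>s\<in>S. g \<otimes> s = s \<otimes> g}" using ab by simp
qed (use assms in \<open>auto simp: subset_iff intro!: exI[of _ \<one>]\<close>)

text \<open>Two passes through a centralizer: that of \<open>T\<close> contains \<open>S\<close>,
  hence \<open>g\<close>; that of \<open>g\<close> then contains \<open>T\<close>, hence
  \<open>h\<close>.\<close>

lemma generate_commute:
  assumes "S \<subseteq> carrier G" "T \<subseteq> carrier G"
    and "\<And>s t. s \<in> S \<Longrightarrow> t \<in> T \<Longrightarrow> s \<otimes> t = t \<otimes> s"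
    and g: "g \<in> generate G S" and h: "h \<in> generate G T"
  shows "g \<otimes> h = h \<otimes> g"
proof -
  have gT: "g \<otimes> t = t \<otimes> g" if "t \<in> T" for t
    using generate_subgroup_incl[OF _ subgroup_centralizer[OF assms(2)], of S] assms that by auto
  have "g \<in> carrier G" using g assms by (simp add: generate_in_carrier)
  moreover have "T \<subseteq> {k \<in> carrier G. \<forall>s\<in>{g}. k \<otimes> s = s \<otimes> k}" using assms(2) gT by auto
  ultimately have "h \<otimes> g = g \<otimes> h"
    using generate_subgroup_incl[OF _ subgroup_centralizer[of "{g}"], of T] h by auto
  then show ?thesis by simp
qed

text \<open>Here \<open>z\<close> is the commutator [u,v]. Moving \<open>u\<close> past one factor
  \<open>v\<close> costs one \<open>z\<close>, and the copies of \<open>z\<close> can be collected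
  on the left since \<open>z\<close> commutes with \<open>v\<close>; so [u,v^n] = z^n.\<close>

lemma pow_commute_upto:
  assumes "u \<in> carrier G" "v \<in> carrier G" "z \<in> carrier G"
    and "u \<otimes> v = z \<otimes> (v \<otimes> u)" "z \<otimes> v = v \<otimes> z"
  shows "u \<otimes> v [^] (n::nat) = z [^] n \<otimes> (v [^] n \<otimes> u)"
proof (induction n)
  case (Suc n)
  have zv: "z \<otimes> v [^] n = v [^] n \<otimes> z" using assms group_commutes_pow[of v z n] by simp
  have "u \<otimes> v [^] Suc n = (u \<otimes> v [^] n) \<otimes> v" using assms by (simp add: m_assoc)
  also have "\<dots> = z [^] n \<otimes> (v [^] n \<otimes> (u \<otimes> v))" using assms Suc by (simp add: m_assoc)
  also have "\<dots> = z [^] n \<otimes> ((v [^] n \<otimes> z) \<otimes> (v \<otimes> u))" using assms by (simp add: m_assoc)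
  also have "\<dots> = z [^] Suc n \<otimes> (v [^] Suc n \<otimes> u)" using assms by (simp add: m_assoc flip: zv)
  finally show ?case .
qed (use assms in simp)

lemma pow_eq_one_coprime:
  assumes z: "z \<in> carrier G" and "z [^] (m::nat) = \<one>" "z [^] (n::nat) = \<one>" "coprime m n"
  shows "z = \<one>"
proof -
  have "ord z dvd m" "ord z dvd n" using assms by (simp_all add: pow_eq_id)
  then have "ord z = 1" using \<open>coprime m n\<close> by (metis coprime_common_divisor_nat nat_dvd_1_iff_1 coprime_def)
  then show ?thesis using z by (metis ord_eq_1)
qed

text \<open>The commutator \<open>z\<close> = [u,v] commutes with both arguments, so [u^m,v] = z^m
  and [u,v^n] = z^n. Both are trivial by assumption, and coprime exponents leave only z = 1.\<close>

lemma commute_if_coprime_powers_commute: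
  assumes uv: "u \<in> carrier G" "v \<in> carrier G" "z \<in> carrier G"
    and z: "u \<otimes> v = z \<otimes> (v \<otimes> u)" "z \<otimes> u = u \<otimes> z" "z \<otimes> v = v \<otimes> z"
    and m: "u [^] (m::nat) \<otimes> v = v \<otimes> u [^] m" and n: "v [^] (n::nat) \<otimes> u = u \<otimes> v [^] n"
    and "coprime m n"
  shows "u \<otimes> v = v \<otimes> u"
proof -
  have "z [^] n \<otimes> (v [^] n \<otimes> u) = v [^] n \<otimes> u"
    using pow_commute_upto[OF uv z(1,3), of n] n by simp
  then have zn: "z [^] n = \<one>" using uv by (simp add: r_cancel_one)
  \<comment> \<open>The roles of \<open>u\<close> and \<open>v\<close> are exchanged:
    \<open>inv z\<close> takes the place of \<open>z\<close>, and the power now falls on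
    \<open>u\<close>.\<close>
  have "v \<otimes> u = inv z \<otimes> (u \<otimes> v)" using uv z(1) by simp
  moreover have "inv z \<otimes> u = u \<otimes> inv z"
    using uv z(2) by (intro inv_commute)
  ultimately have "v \<otimes> u [^] m = inv z [^] m \<otimes> (u [^] m \<otimes> v)"
    using uv by (intro pow_commute_upto) auto
  then have "inv z [^] m = \<one>" using uv m by (simp add: r_cancel_one)
  then have "z [^] m = \<one>" using uv by (simp add: nat_pow_inv)
  then have "z = \<one>" using zn uv \<open>coprime m n\<close> by (intro pow_eq_one_coprime[of z m n]) auto
  then show ?thesis using uv z by simp
qed

end

section \<open>Homomorphic images and quotients by normal subgroups\<close>

lemma (in group_hom) comm_subgroup_image:
  assumes "A \<subseteq> carrier G" "B \<subseteq> carrier G"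
  shows "h ` comm_subgroup G A B = comm_subgroup H (h ` A) (h ` B)"
proof -
  let ?S = "{a \<otimes> b \<otimes> inv a \<otimes> inv b | a b. a \<in> A \<and> b \<in> B}"
  have "h ` ?S = {a \<otimes>\<^bsub>H\<^esub> b \<otimes>\<^bsub>H\<^esub> inv\<^bsub>H\<^esub> a \<otimes>\<^bsub>H\<^esub> inv\<^bsub>H\<^esub> b | a b. a \<in> h ` A \<and> b \<in> h ` B}"
    (is "_ = ?T")
  proof (intro equalityI subsetI)
    fix y assume "y \<in> h ` ?S"
    then obtain a b where "y = h (a \<otimes> b \<otimes> inv a \<otimes> inv b)" "a \<in> A" "b \<in> B" by auto
    moreover from this have "y = h a \<otimes>\<^bsub>H\<^esub> h b \<otimes>\<^bsub>H\<^esub> inv\<^bsub>H\<^esub> h a \<otimes>\<^bsub>H\<^esub> inv\<^bsub>H\<^esub> h b"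
      using assms by (simp add: subset_iff)
    ultimately show "y \<in> ?T" by blast
  next
    fix y assume "y \<in> ?T"
    then obtain a b where "y = h a \<otimes>\<^bsub>H\<^esub> h b \<otimes>\<^bsub>H\<^esub> inv\<^bsub>H\<^esub> h a \<otimes>\<^bsub>H\<^esub> inv\<^bsub>H\<^esub> h b"
      and ab: "a \<in> A" "b \<in> B" by auto
    then have "y = h (a \<otimes> b \<otimes> inv a \<otimes> inv b)" using assms by (simp add: subset_iff)
    with ab show "y \<in> h ` ?S" by blast
  qed
  moreover have "?S \<subseteq> carrier G" using assms by (auto simp: subset_iff)
  ultimately show ?thesis unfolding comm_subgroup_def using generate_img[of ?S] by simp
qed

text \<open>Surjectivity keeps the second argument right at every stage: the image of
  \<open>carrier G\<close> has to be all of \<open>carrier H\<close>.\<close>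

lemma (in group_hom) iter_comm_image:
  assumes "A \<lhd> G" and surj: "h ` carrier G = carrier H"
  shows "h ` iter_comm G A n = iter_comm H (h ` A) n"
proof (induction n)
  case (Suc n)
  have "iter_comm G A n \<subseteq> carrier G"
    using G.iter_comm_normal[OF assms(1)] by (meson normal_imp_subgroup subgroup.subset)
  with Suc show ?case by (simp add: comm_subgroup_image surj)
qed simp

lemma (in normal) rcos_eq_iff:
  assumes "a \<in> carrier G" "b \<in> carrier G"
  shows "H #> a = H #> b \<longleftrightarrow> a \<otimes> inv b \<in> H"
proof
  assume "H #> a = H #> b"
  then have "a \<in> H #> b" using rcos_self[OF assms(1) subgroup_axioms] by simp
  then show "a \<otimes> inv b \<in> H" using assms rcos_module[OF is_group] by blast
next
  assume "a \<otimes> inv b \<in> H"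
  then have "a \<in> H #> b" using assms rcos_module[OF is_group] by blast
  then show "H #> a = H #> b" using repr_independence[OF _ assms(2) subgroup_axioms] by simp
qed

lemma (in normal) rcos_eq_self_iff: "a \<in> carrier G \<Longrightarrow> H #> a = H \<longleftrightarrow> a \<in> H"
  using rcos_eq_iff[of a \<one>] coset_mult_one[OF subset] by simp

lemma (in normal) rcos_commute_iff:
  assumes "a \<in> carrier G" "b \<in> carrier G"
  shows "(H #> a) <#> (H #> b) = (H #> b) <#> (H #> a) \<longleftrightarrow> a \<otimes> b \<otimes> inv a \<otimes> inv b \<in> H"
  using assms rcos_eq_iff[of "a \<otimes> b" "b \<otimes> a"] by (simp add: rcos_sum inv_mult_group m_assoc)

lemma (in normal) group_hom_Mod: "group_hom G (G Mod H) (\<lambda>a. H #> a)"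
  by (simp add: group_hom_def group_hom_axioms_def factorgroup_is_group r_coset_hom_Mod is_group)

lemma (in normal) surj_Mod: "(\<lambda>a. H #> a) ` carrier G = carrier (G Mod H)"
  by (simp add: carrier_FactGroup)

section \<open>Free groups\<close>

lemma not_reduced_word_split:
  "\<not> reduced_word w \<Longrightarrow> \<exists>u v b y. w = u @ (b, y) # (\<not> b, y) # v"
proof (induction w rule: reduced_word.induct)
  case (3 b x b' y w)
  show ?case
  proof (cases "x = y \<and> b \<noteq> b'")
    case True
    then have "(b, x) # (b', y) # w = [] @ (b, x) # (\<not> b, x) # w" by auto
    then show ?thesis by blast
  next
    case False
    then have "\<not> reduced_word ((b', y) # w)" using 3(2) by auto
    then obtain u v d z where "(b', y) # w = u @ (d, z) # (\<not> d, z) # v" using 3(1) by blast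
    then have "(b, x) # (b', y) # w = ((b, x) # u) @ (d, z) # (\<not> d, z) # v" by simp
    then show ?thesis by blast
  qed
qed auto

lemma (in group) word_eval_closed: "snd ` set w \<subseteq> carrier G \<Longrightarrow> word_eval G w \<in> carrier G"
proof (induction w)
  case (Cons p w)
  then show ?case by (cases p; cases "fst p") auto
qed simp

lemma (in group) word_eval_append:
  "snd ` set u \<subseteq> carrier G \<Longrightarrow> snd ` set v \<subseteq> carrier G \<Longrightarrow>
    word_eval G (u @ v) = word_eval G u \<otimes> word_eval G v"
proof (induction u)
  case (Cons p u)
  then show ?case by (cases p; cases "fst p") (auto simp: m_assoc word_eval_closed)
qed (simp add: word_eval_closed)

lemma (in group) word_eval_cancel:
  assumes "snd ` set u \<subseteq> carrier G" "snd ` set v \<subseteq> carrier G" "y \<in> carrier G"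
  shows "word_eval G (u @ (b, y) # (\<not> b, y) # v) = word_eval G (u @ v)"
  using assms by (cases b) (auto simp: word_eval_append word_eval_closed)

lemma (in group) generate_imp_word_eval:
  assumes "g \<in> generate G B" "B \<subseteq> carrier G"
  shows "\<exists>w. snd ` set w \<subseteq> B \<and> word_eval G w = g"
  using assms(1)
proof induction
  case one
  then show ?case by (intro exI[of _ "[]"]) auto
next
  case (incl h)
  then show ?case using assms(2) by (intro exI[of _ "[(True, h)]"]) auto
next
  case (inv h)
  then show ?case using assms(2) by (intro exI[of _ "[(False, h)]"]) auto
next
  case (eng h1 h2)
  then obtain u v where "snd ` set u \<subseteq> B" "word_eval G u = h1" "snd ` set v \<subseteq> B" "word_eval G v = h2"
    by blast
  then show ?case using assms(2) by (intro exI[of _ "u @ v"]) (auto simp: word_eval_append)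
qed

text \<open>Freeness is given as the absence of nonempty reduced words with value one. A nonempty
  word with value one thus contains a cancelling pair; removing it changes neither the value in
  \<open>F\<close> nor that of the relabelled word in \<open>H\<close>, and induction on the length
  applies.\<close>

lemma free_basis_word_eval_one:
  assumes "free_basis F B" "group H" "\<And>b. b \<in> B \<Longrightarrow> f b \<in> carrier H"
  shows "snd ` set w \<subseteq> B \<Longrightarrow> word_eval F w = \<one>\<^bsub>F\<^esub> \<Longrightarrow> word_eval H (map (apsnd f) w) = \<one>\<^bsub>H\<^esub>"
proof (induction "length w" arbitrary: w rule: less_induct)
  case less
  interpret F: group F using assms(1) by (simp add: free_basis_def)
  interpret H: group H by fact
  have B: "B \<subseteq> carrier F" using assms(1) by (simp add: free_basis_def)
  show ?case
  proof (cases "w = []")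
    case False
    then have "\<not> reduced_word w" using assms(1) less.prems by (auto simp: free_basis_def)
    then obtain u v b y where w: "w = u @ (b, y) # (\<not> b, y) # v" using not_reduced_word_split by blast
    have uv: "snd ` set u \<subseteq> B" "snd ` set v \<subseteq> B" "y \<in> B" using less.prems w by auto
    then have "word_eval F (u @ v) = \<one>\<^bsub>F\<^esub>"
      using less.prems(2) B unfolding w by (subst (asm) F.word_eval_cancel) auto
    then have "word_eval H (map (apsnd f) (u @ v)) = \<one>\<^bsub>H\<^esub>"
      using uv w by (intro less.hyps) auto
    moreover have "word_eval H (map (apsnd f) w) = word_eval H (map (apsnd f) u @ map (apsnd f) v)"
      unfolding w using uv assms(3) by (simp, subst H.word_eval_cancel) (auto simp: image_iff subset_iff)
    ultimately show ?thesis by simp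
  qed simp
qed

lemma (in group) word_eval_rev:
  "snd ` set w \<subseteq> carrier G \<Longrightarrow> word_eval G (rev (map (apfst Not) w)) = inv word_eval G w"
proof (induction w)
  case (Cons p w)
  obtain b y where p: "p = (b, y)" by force
  have "snd ` set (rev (map (apfst Not) w)) \<subseteq> carrier G" using Cons.prems by (auto simp: image_iff)
  then show ?case using Cons p
    by (cases b) (auto simp: word_eval_append inv_mult_group word_eval_closed)
qed simp

text \<open>The universal property. An element is sent to the value in \<open>H\<close> of a chosen
  word for it. The choice is harmless: if two words represent the same element, the first followed
  by the formal inverse of the second has value one in \<open>F\<close>, hence also in
  \<open>H\<close>.\<close>

lemma free_basis_extend_hom:
  assumes F: "free_basis F B" and H: "group H" and f: "\<And>b. b \<in> B \<Longrightarrow> f b \<in> carrier H"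
  obtains \<phi> where "\<phi> \<in> hom F H" "\<And>b. b \<in> B \<Longrightarrow> \<phi> b = f b"
proof -
  interpret F: group F using F by (simp add: free_basis_def)
  interpret H: group H by fact
  have B: "B \<subseteq> carrier F" and gen: "generate F B = carrier F" using F by (simp_all add: free_basis_def)
  let ?ev = "\<lambda>w. word_eval H (map (apsnd f) w)"
  have cl: "snd ` set (map (apsnd f) w) \<subseteq> carrier H" if "snd ` set w \<subseteq> B" for w
    using that f by (auto simp: image_iff subset_iff)
  have wd: "?ev u = ?ev v" if "snd ` set u \<subseteq> B" "snd ` set v \<subseteq> B" "word_eval F u = word_eval F v" for u v
  proof -
    let ?v = "rev (map (apfst Not) v)"
    have v': "snd ` set ?v \<subseteq> B" using that by (auto simp: image_iff)
    have "word_eval F (u @ ?v) = \<one>\<^bsub>F\<^esub>"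
      using that B v' by (subst F.word_eval_append) (auto simp: F.word_eval_rev F.word_eval_closed)
    then have "?ev (u @ ?v) = \<one>\<^bsub>H\<^esub>"
      using that v' by (intro free_basis_word_eval_one[OF F H f]) auto
    moreover have "map (apsnd f) ?v = rev (map (apfst Not) (map (apsnd f) v))"
      by (simp add: rev_map)
    ultimately have "?ev u \<otimes>\<^bsub>H\<^esub> inv\<^bsub>H\<^esub> ?ev v = \<one>\<^bsub>H\<^esub>"
      using cl[OF that(1)] cl[OF that(2)] cl[OF v'] H.word_eval_append H.word_eval_rev
      by (metis map_append)
    then show ?thesis
      using cl[OF that(1)] cl[OF that(2)] H.word_eval_closed
      by (metis H.inv_closed H.inv_equality H.inv_inv)
  qed
  define word where "word g = (SOME w. snd ` set w \<subseteq> B \<and> word_eval F w = g)" for g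
  have word: "snd ` set (word g) \<subseteq> B" "word_eval F (word g) = g" if "g \<in> carrier F" for g
    using someI_ex[OF F.generate_imp_word_eval[of g B]] B gen that unfolding word_def by auto
  have "(\<lambda>g. ?ev (word g)) \<in> hom F H"
  proof (rule homI)
    fix g assume "g \<in> carrier F"
    then show "?ev (word g) \<in> carrier H" by (intro H.word_eval_closed cl word)
  next
    fix g h assume gh: "g \<in> carrier F" "h \<in> carrier F"
    have "word_eval F (word g @ word h) = g \<otimes>\<^bsub>F\<^esub> h"
      using word(1)[OF gh(1)] word(1)[OF gh(2)] B by (subst F.word_eval_append) (auto simp: word(2) gh)
    then have "?ev (word (g \<otimes>\<^bsub>F\<^esub> h)) = ?ev (word g @ word h)"
      using word(1)[OF gh(1)] word(1)[OF gh(2)] word[of "g \<otimes>\<^bsub>F\<^esub> h"] gh by (intro wd) auto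
    then show "?ev (word (g \<otimes>\<^bsub>F\<^esub> h)) = ?ev (word g) \<otimes>\<^bsub>H\<^esub> ?ev (word h)"
      using H.word_eval_append[OF cl[OF word(1)[OF gh(1)]] cl[OF word(1)[OF gh(2)]]] by simp
  qed
  moreover have "?ev (word b) = f b" if "b \<in> B" for b
  proof -
    have "?ev (word b) = ?ev [(True, b)]"
      using that B word[of b] by (intro wd) auto
    then show ?thesis using f that by simp
  qed
  ultimately show ?thesis using that by blast
qed

section \<open>Groups generated modulo a normal subgroup by elements of coprime orders\<close>

context group
begin

text \<open>Modulo W = [K,G] gamma_3 the images of \<open>K\<close> and of gamma_2 are central. So
  the commutator of \<open>e i\<close> and \<open>e j\<close> is central there, as are the
  \<open>r i\<close>-th power of \<open>e i\<close> and the \<open>r j\<close>-th power of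
  \<open>e j\<close>, and coprimality makes \<open>e i\<close> and \<open>e j\<close> commute. The
  quotient by W is then generated by commuting elements, hence abelian.\<close>

lemma lcs_one_subset_of_coprime_generators:
  fixes r :: "'i \<Rightarrow> nat"
  assumes K: "K \<lhd> G"
    and e: "\<And>i. i \<in> I \<Longrightarrow> e i \<in> carrier G"
    and er: "\<And>i. i \<in> I \<Longrightarrow> e i [^] r i \<in> K"
    and cop: "\<And>i j. i \<in> I \<Longrightarrow> j \<in> I \<Longrightarrow> i \<noteq> j \<Longrightarrow> coprime (r i) (r j)"
    and gen: "generate G (K \<union> e ` I) = carrier G"
  shows "iter_comm G (carrier G) 1 \<subseteq> iter_comm G K 1 <#> iter_comm G (carrier G) 2"
proof -
  let ?C = "iter_comm G (carrier G)"
  define W where "W = iter_comm G K 1 <#> ?C 2"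
  have Wn: "W \<lhd> G" unfolding W_def by (intro set_mult_normal iter_comm_normal K carrier_normal)
  then interpret W: normal W G .
  interpret Q: group "G Mod W" by (rule W.factorgroup_is_group)
  let ?p = "\<lambda>a. W #> a"
  interpret p: group_hom G "G Mod W" ?p by (rule W.group_hom_Mod)
  interpret Kn: normal K G by fact
  have C1n: "?C 1 \<lhd> G" by (intro iter_comm_normal carrier_normal)
  have sup: "iter_comm G K 1 \<subseteq> W" "?C 2 \<subseteq> W"
    unfolding W_def by (intro set_mult_supset normal_imp_subgroup iter_comm_normal K carrier_normal)+
  have Kcomm: "?p k \<otimes>\<^bsub>G Mod W\<^esub> ?p g = ?p g \<otimes>\<^bsub>G Mod W\<^esub> ?p k"
    if "k \<in> K" "g \<in> carrier G" for k g
    using that sup(1) commutator_in_comm_subgroup[of k K g "carrier G"]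
    by (auto simp: W.rcos_commute_iff)
  \<comment> \<open>\<open>?C 1\<close> is gamma_2, and \<open>?C 2\<close> is gamma_3 =
    [gamma_2,G], which lies in \<open>W\<close>.\<close>
  have Ccomm: "?p k \<otimes>\<^bsub>G Mod W\<^esub> ?p g = ?p g \<otimes>\<^bsub>G Mod W\<^esub> ?p k"
    if "k \<in> ?C 1" "g \<in> carrier G" for k g
    using that sup(2) commutator_in_comm_subgroup[of k "?C 1" g "carrier G"] subgroup.mem_carrier[OF normal_imp_subgroup[OF C1n]]
    by (auto simp: W.rcos_commute_iff numeral_2_eq_2)
  have ecomm: "?p (e i) \<otimes>\<^bsub>G Mod W\<^esub> ?p (e j) = ?p (e j) \<otimes>\<^bsub>G Mod W\<^esub> ?p (e i)"
    if ij: "i \<in> I" "j \<in> I" for i j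
  proof (cases "i = j")
    case False
    let ?z = "e i \<otimes> e j \<otimes> inv (e i) \<otimes> inv (e j)"
    have z: "?z \<in> ?C 1" using ij e by (simp add: commutator_in_comm_subgroup)
    have zc: "?z \<in> carrier G" using ij e by simp
    show ?thesis
    proof (rule Q.commute_if_coprime_powers_commute)
      show "?p (e i) \<otimes>\<^bsub>G Mod W\<^esub> ?p (e j) = ?p ?z \<otimes>\<^bsub>G Mod W\<^esub> (?p (e j) \<otimes>\<^bsub>G Mod W\<^esub> ?p (e i))"
        using ij e zc by (simp add: m_assoc flip: p.hom_mult del: mult_FactGroup)
      show "?p ?z \<otimes>\<^bsub>G Mod W\<^esub> ?p (e i) = ?p (e i) \<otimes>\<^bsub>G Mod W\<^esub> ?p ?z"
        by (rule Ccomm[OF z e[OF ij(1)]])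
      show "?p ?z \<otimes>\<^bsub>G Mod W\<^esub> ?p (e j) = ?p (e j) \<otimes>\<^bsub>G Mod W\<^esub> ?p ?z"
        by (rule Ccomm[OF z e[OF ij(2)]])
      show "?p (e i) [^]\<^bsub>G Mod W\<^esub> r i \<otimes>\<^bsub>G Mod W\<^esub> ?p (e j) = ?p (e j) \<otimes>\<^bsub>G Mod W\<^esub> ?p (e i) [^]\<^bsub>G Mod W\<^esub> r i"
        using ij e er Kcomm by (simp flip: p.hom_nat_pow)
      show "?p (e j) [^]\<^bsub>G Mod W\<^esub> r j \<otimes>\<^bsub>G Mod W\<^esub> ?p (e i) = ?p (e i) \<otimes>\<^bsub>G Mod W\<^esub> ?p (e j) [^]\<^bsub>G Mod W\<^esub> r j"
        using ij e er Kcomm by (simp flip: p.hom_nat_pow)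
      show "coprime (r i) (r j)" using cop ij False by blast
    qed (intro p.hom_closed e ij zc)+
  qed simp
  have S: "K \<union> e ` I \<subseteq> carrier G" using e by auto
  then have pS: "?p ` (K \<union> e ` I) \<subseteq> carrier (G Mod W)" using p.hom_closed by blast
  have genQ: "generate (G Mod W) (?p ` (K \<union> e ` I)) = carrier (G Mod W)"
    using p.generate_img[OF S] gen W.surj_Mod by simp
  have comm: "s \<otimes>\<^bsub>G Mod W\<^esub> t = t \<otimes>\<^bsub>G Mod W\<^esub> s"
    if "s \<in> ?p ` (K \<union> e ` I)" "t \<in> ?p ` (K \<union> e ` I)" for s t
  proof -
    obtain a b where ab: "s = ?p a" "a \<in> K \<union> e ` I" "t = ?p b" "b \<in> K \<union> e ` I" using \<open>s \<in> _\<close> \<open>t \<in> _\<close> by blast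
    then have "a \<in> carrier G" "b \<in> carrier G" using S by auto
    then show ?thesis using ab Kcomm[of a b] Kcomm[of b a] ecomm by (auto simp del: mult_FactGroup)
  qed
  have "comm_subgroup G (carrier G) (carrier G) \<subseteq> W"
  proof (rule comm_subgroup_incl[OF W.subgroup_axioms])
    fix g h assume gh: "g \<in> carrier G" "h \<in> carrier G"
    then have "?p g \<otimes>\<^bsub>G Mod W\<^esub> ?p h = ?p h \<otimes>\<^bsub>G Mod W\<^esub> ?p g"
      using genQ p.hom_closed by (intro Q.generate_commute[OF pS pS comm]) auto
    then show "g \<otimes> h \<otimes> inv g \<otimes> inv h \<in> W" using gh by (simp add: W.rcos_commute_iff)
  qed
  then show ?thesis by (simp add: W_def)
qed

text \<open>Taking commutators with \<open>G\<close> carries the inclusion one step down both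
  series, since \<open>comm_subgroup_set_mult\<close> splits the commutators of a product.\<close>

lemma lcs_Suc_subset:
  assumes K: "K \<lhd> G"
    and one: "iter_comm G (carrier G) 1 \<subseteq> iter_comm G K 1 <#> iter_comm G (carrier G) 2"
  shows "iter_comm G (carrier G) (Suc n)
    \<subseteq> iter_comm G K (Suc n) <#> iter_comm G (carrier G) (Suc (Suc n))"
proof (induction n)
  case 0
  then show ?case using one by (simp add: numeral_2_eq_2)
next
  case (Suc n)
  have "iter_comm G (carrier G) (Suc (Suc n)) \<subseteq>
      comm_subgroup G (iter_comm G K (Suc n) <#> iter_comm G (carrier G) (Suc (Suc n))) (carrier G)"
    using comm_subgroup_mono[OF Suc order_refl] by simp
  also have "\<dots> \<subseteq> comm_subgroup G (iter_comm G K (Suc n)) (carrier G)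
      <#> comm_subgroup G (iter_comm G (carrier G) (Suc (Suc n))) (carrier G)"
    by (intro comm_subgroup_set_mult iter_comm_normal K carrier_normal)
  finally show ?case by simp
qed

text \<open>Each step bounds gamma_(n+2) by \<open>lcs_Suc_subset\<close> and absorbs the first
  factor into \<open>K\<close>, using KK = K. Hence the quotient by \<open>K\<close> times a later
  term of the lower central series is still abelian.\<close>

lemma lcs_one_subset:
  assumes K: "K \<lhd> G"
    and one: "iter_comm G (carrier G) 1 \<subseteq> iter_comm G K 1 <#> iter_comm G (carrier G) 2"
  shows "iter_comm G (carrier G) 1 \<subseteq> K <#> iter_comm G (carrier G) (Suc n)"
proof (induction n)
  case 0
  show ?case
    using set_mult_supset(2)[OF normal_imp_subgroup[OF K], of "iter_comm G (carrier G) 1"]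
      normal_imp_subgroup[OF iter_comm_normal[OF carrier_normal, of 1]] by simp
next
  case (Suc n)
  let ?C = "iter_comm G (carrier G) (Suc (Suc n))"
  have sub: "K \<subseteq> carrier G" "?C \<subseteq> carrier G"
    using K iter_comm_normal[OF carrier_normal] by (meson normal_imp_subgroup subgroup.subset)+
  have "iter_comm G (carrier G) (Suc n) \<subseteq> iter_comm G K (Suc n) <#> ?C"
    by (rule lcs_Suc_subset[OF assms])
  also have "\<dots> \<subseteq> K <#> ?C"
    by (intro mono_set_mult iter_comm_subset[OF K] order_refl)
  finally have "K <#> iter_comm G (carrier G) (Suc n) \<subseteq> K <#> (K <#> ?C)"
    by (intro mono_set_mult order_refl)
  also have "\<dots> = K <#> ?C"
    using sub subgroup_mult_id[OF normal_imp_subgroup[OF K]] by (simp flip: set_mult_assoc)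
  finally show ?case using Suc by simp
qed

text \<open>Once the iterated commutator of \<open>K\<close> is trivial, its factor in
  \<open>lcs_Suc_subset\<close> disappears and gamma_(n+2) lies in gamma_(n+3).\<close>

lemma lcs_stabilizes:
  assumes K: "K \<lhd> G"
    and one: "iter_comm G (carrier G) 1 \<subseteq> iter_comm G K 1 <#> iter_comm G (carrier G) 2"
    and "iter_comm G K (Suc n) = {\<one>}"
  shows "iter_comm G (carrier G) (Suc (Suc n)) = iter_comm G (carrier G) (Suc n)"
proof
  let ?C = "iter_comm G (carrier G) (Suc (Suc n))"
  have "?C \<subseteq> carrier G"
    using iter_comm_normal[OF carrier_normal] by (meson normal_imp_subgroup subgroup.subset)
  then have "{\<one>} <#> ?C = ?C" by (force simp: set_mult_def subset_iff)
  then show "iter_comm G (carrier G) (Suc n) \<subseteq> ?C"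
    using lcs_Suc_subset[OF K one, of n] assms(3) by simp
qed (rule iter_comm_Suc_subset[OF carrier_normal])

text \<open>Descending induction on \<open>m\<close>, from \<open>c\<close> where the term is
  trivial down to 0, shows that \<open>iter_comm G K m\<close> centralizes \<open>L\<close>.
  Conjugation by an element of the m-th term multiplies \<open>l\<close> by a central element and
  \<open>e\<close> by an element of the next term, which centralizes \<open>L\<close>; so it fixes
  [l,e], and these commutators generate \<open>L\<close>.\<close>

lemma hypercentral_commutes:
  assumes K: "K \<lhd> G" and L: "L \<lhd> G" and perf: "comm_subgroup G L (carrier G) = L"
    and nil: "iter_comm G K c = {\<one>}"
    and central: "\<And>a g. a \<in> K \<inter> L \<Longrightarrow> g \<in> carrier G \<Longrightarrow> a \<otimes> g = g \<otimes> a"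
    and kl: "k \<in> K" "l \<in> L"
  shows "k \<otimes> l = l \<otimes> k"
proof -
  interpret K: normal K G by fact
  interpret L: normal L G by fact
  have "\<forall>k\<in>iter_comm G K 0. \<forall>l\<in>L. k \<otimes> l = l \<otimes> k"
  proof (rule inc_induct[of 0 c])
    show "\<forall>k\<in>iter_comm G K c. \<forall>l\<in>L. k \<otimes> l = l \<otimes> k" by (simp add: nil)
  next
    fix m assume IH: "\<forall>k\<in>iter_comm G K (Suc m). \<forall>l\<in>L. k \<otimes> l = l \<otimes> k"
    show "\<forall>k\<in>iter_comm G K m. \<forall>l\<in>L. k \<otimes> l = l \<otimes> k"
    proof
      fix k assume km: "k \<in> iter_comm G K m"
      then have kK: "k \<in> K" using iter_comm_subset[OF K] by blast
      then have k: "k \<in> carrier G" by simp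
      have "comm_subgroup G L (carrier G) \<subseteq> {g \<in> carrier G. \<forall>s\<in>{k}. g \<otimes> s = s \<otimes> g}"
      proof (rule comm_subgroup_incl)
        show "subgroup {g \<in> carrier G. \<forall>s\<in>{k}. g \<otimes> s = s \<otimes> g} G"
          using k by (intro subgroup_centralizer) simp
        fix l e assume lL: "l \<in> L" and e: "e \<in> carrier G"
        then have l: "l \<in> carrier G" by simp
        let ?w = "l \<otimes> e \<otimes> inv l \<otimes> inv e"
        \<comment> \<open>\<open>a\<close> and \<open>u\<close> record how conjugation by
          \<open>k\<close> moves \<open>l\<close> and \<open>e\<close>: k l k^-1 = a l and k e k^-1
          = u e.\<close>
        define a where "a = k \<otimes> l \<otimes> inv k \<otimes> inv l"
        define u where "u = k \<otimes> e \<otimes> inv k \<otimes> inv e"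
        have w: "?w \<in> L" using lL e perf commutator_in_comm_subgroup by blast
        have "k \<otimes> (l \<otimes> inv k \<otimes> inv l) \<in> K"
          using kK l by (intro K.m_closed K.inv_op_closed2) auto
        moreover have "(k \<otimes> l \<otimes> inv k) \<otimes> inv l \<in> L"
          using k lL by (intro L.m_closed L.inv_op_closed2) auto
        ultimately have "a \<in> K \<inter> L" using k l by (simp add: a_def m_assoc)
        then have a: "a \<in> carrier G" and ac: "\<And>g. g \<in> carrier G \<Longrightarrow> a \<otimes> g = g \<otimes> a"
          using central by auto
        have u: "u \<in> iter_comm G K (Suc m)"
          unfolding u_def using km e by (simp add: commutator_in_comm_subgroup)
        then have uc: "u \<in> carrier G" using k e by (simp add: u_def)
        \<comment> \<open>First [al,ue] = [l,ue] because \<open>a\<close> is central; then [l,ue] =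
          u[l,e]u^-1 = [l,e] because \<open>u\<close> commutes with \<open>l\<close> and with
          \<open>?w\<close>.\<close>
        have "k \<otimes> ?w \<otimes> inv k = (a \<otimes> l) \<otimes> (u \<otimes> e) \<otimes> inv (a \<otimes> l) \<otimes> inv (u \<otimes> e)"
          using k l e by (simp add: a_def u_def m_assoc inv_mult_group)
        also have "\<dots> = a \<otimes> (l \<otimes> (u \<otimes> e) \<otimes> inv l) \<otimes> inv a \<otimes> inv (u \<otimes> e)"
          using a l uc e by (simp add: m_assoc inv_mult_group)
        also have "\<dots> = l \<otimes> u \<otimes> e \<otimes> inv l \<otimes> inv e \<otimes> inv u"
          using a l uc e ac[of "l \<otimes> (u \<otimes> e) \<otimes> inv l"] by (simp add: m_assoc inv_mult_group)
        also have "l \<otimes> u = u \<otimes> l" using IH u lL by simp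
        also have "u \<otimes> l \<otimes> e \<otimes> inv l \<otimes> inv e \<otimes> inv u = u \<otimes> ?w \<otimes> inv u"
          using l uc e by (simp add: m_assoc)
        also have "u \<otimes> ?w = ?w \<otimes> u" using IH u w by blast
        also have "?w \<otimes> u \<otimes> inv u = ?w" using uc l e by (simp add: m_assoc)
        finally have kw: "k \<otimes> ?w \<otimes> inv k = ?w" .
        have wc: "?w \<in> carrier G" using l e by simp
        have "?w \<otimes> k = k \<otimes> ?w \<otimes> inv k \<otimes> k" by (simp only: kw)
        also have "\<dots> = k \<otimes> ?w" using k wc by (simp only: m_assoc l_inv r_one inv_closed m_closed)
        finally show "?w \<in> {g \<in> carrier G. \<forall>s\<in>{k}. g \<otimes> s = s \<otimes> g}" using wc by simp
      qed
      then show "\<forall>l\<in>L. k \<otimes> l = l \<otimes> k" unfolding perf by auto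
    qed
  qed simp
  then show ?thesis using kl by auto
qed

end

section \<open>Chinese remainder lifting and powers of the lifts\<close>

lemma (in comm_group) finprod_nat_pow:
  assumes "finite I" "f \<in> I \<rightarrow> carrier G"
  shows "finprod G f I [^] (n::nat) = finprod G (\<lambda>i. f i [^] n) I"
  using assms
proof (induction I rule: finite_induct)
  case (insert i I)
  have "(\<lambda>i. f i [^] n) \<in> I \<rightarrow> carrier G" using insert by auto
  then show ?case using insert by (simp add: pow_mult_distrib m_comm Pi_iff)
qed simp

context group
begin

lemma subgroup_nat_pow_closed: "subgroup H G \<Longrightarrow> h \<in> H \<Longrightarrow> h [^] (n::nat) \<in> H"
  using subgroup_int_pow_closed[of H h "int n"] by (simp add: int_pow_int)

text \<open>In the abelian quotient \<open>f\<close> is the product of all \<open>e i\<close>. The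
  cofactor times \<open>s i\<close> is divisible by every other \<open>r j\<close> and congruent to
  1 modulo \<open>r i\<close>, so this power of \<open>f\<close> isolates \<open>e i\<close>. The
  same congruence makes \<open>s i\<close> coprime to \<open>r i\<close>.\<close>

lemma crt_lift_abelian_quotient:
  fixes r :: "'i \<Rightarrow> nat"
  assumes N: "N \<lhd> G" and ab: "comm_subgroup G (carrier G) (carrier G) \<subseteq> N"
    and I: "finite I" and e: "\<And>i. i \<in> I \<Longrightarrow> e i \<in> carrier G"
    and er: "\<And>i. i \<in> I \<Longrightarrow> e i [^] r i \<in> N"
    and cop: "\<And>i j. i \<in> I \<Longrightarrow> j \<in> I \<Longrightarrow> i \<noteq> j \<Longrightarrow> coprime (r i) (r j)"
  obtains f s where "f \<in> carrier G" "f [^] (\<Prod>i\<in>I. r i) \<in> N"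
    and "\<And>i. i \<in> I \<Longrightarrow> coprime (s i) (r i)"
    and "\<And>i. i \<in> I \<Longrightarrow> e i \<otimes> inv (f [^] ((\<Prod>j\<in>I-{i}. r j) * s i)) \<in> N"
proof -
  interpret N: normal N G by fact
  interpret Q: group "G Mod N" by (rule N.factorgroup_is_group)
  let ?p = "\<lambda>a. N #> a"
  interpret p: group_hom G "G Mod N" ?p by (rule N.group_hom_Mod)
  interpret Q: comm_group "G Mod N"
  proof (rule Q.group_comm_groupI)
    fix A B assume "A \<in> carrier (G Mod N)" "B \<in> carrier (G Mod N)"
    then obtain a b where "A = ?p a" "B = ?p b" "a \<in> carrier G" "b \<in> carrier G"
      by (auto simp: carrier_FactGroup)
    then show "A \<otimes>\<^bsub>G Mod N\<^esub> B = B \<otimes>\<^bsub>G Mod N\<^esub> A"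
      using ab commutator_in_comm_subgroup[of a "carrier G" b "carrier G"] by (auto simp: N.rcos_commute_iff)
  qed
  have pe: "?p (e i) \<in> carrier (G Mod N)" if "i \<in> I" for i by (intro p.hom_closed e that)
  have per: "?p (e i) [^]\<^bsub>G Mod N\<^esub> n = \<one>\<^bsub>G Mod N\<^esub>" if "i \<in> I" "r i dvd n" for i n
  proof -
    have "?p (e i) [^]\<^bsub>G Mod N\<^esub> r i = \<one>\<^bsub>G Mod N\<^esub>"
      using e er that by (simp add: N.rcos_eq_self_iff flip: p.hom_nat_pow)
    then have "Q.ord (?p (e i)) dvd r i" using Q.pow_eq_id[OF pe[OF that(1)]] by simp
    then have "Q.ord (?p (e i)) dvd n" using that(2) by (rule dvd_trans)
    then show ?thesis using Q.pow_eq_id[OF pe[OF that(1)]] by simp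
  qed
  define fQ where "fQ = finprod (G Mod N) (\<lambda>i. ?p (e i)) I"
  have fQ: "fQ \<in> carrier (G Mod N)" unfolding fQ_def using pe by (intro Q.finprod_closed) auto
  then obtain f where f: "f \<in> carrier G" "?p f = fQ" by (auto simp: carrier_FactGroup)
  have fpow: "?p (f [^] n) = finprod (G Mod N) (\<lambda>i. ?p (e i) [^]\<^bsub>G Mod N\<^esub> n) I" for n :: nat
  proof -
    have "?p (f [^] n) = fQ [^]\<^bsub>G Mod N\<^esub> n" using f by (simp add: p.hom_nat_pow)
    then show ?thesis unfolding fQ_def using I pe by (simp add: Q.finprod_nat_pow)
  qed
  \<comment> \<open>The cofactor is coprime to \<open>r i\<close>, and \<open>s\<close> is its
    inverse modulo \<open>r i\<close>.\<close>
  have "\<exists>s. [(\<Prod>j\<in>I-{i}. r j) * s = 1] (mod r i)" if "i \<in> I" for i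
  proof -
    have "coprime (\<Prod>j\<in>I-{i}. r j) (r i)" using that cop by (auto intro!: prod_coprime_left)
    then show ?thesis using cong_solve_coprime_nat by fastforce
  qed
  then obtain s where s: "\<And>i. i \<in> I \<Longrightarrow> [(\<Prod>j\<in>I-{i}. r j) * s i = 1] (mod r i)" by metis
  show thesis
  proof
    show "f \<in> carrier G" by fact
    have "?p (f [^] (\<Prod>i\<in>I. r i)) = \<one>\<^bsub>G Mod N\<^esub>"
      unfolding fpow using I by (intro Q.finprod_one_eqI per) auto
    then show "f [^] (\<Prod>i\<in>I. r i) \<in> N" using f by (simp add: N.rcos_eq_self_iff)
  next
    fix i assume i: "i \<in> I"
    have "coprime ((\<Prod>j\<in>I-{i}. r j) * s i) (r i)"
      using s[OF i] by (metis cong_imp_coprime cong_sym coprime_1_left)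
    then show "coprime (s i) (r i)" by simp
    let ?q = "(\<Prod>j\<in>I-{i}. r j) * s i"
    have "?p (f [^] ?q) = finprod (G Mod N) (\<lambda>j. if j = i then ?p (e j) else \<one>\<^bsub>G Mod N\<^esub>) I"
      unfolding fpow
    proof (rule Q.finprod_cong')
      fix j assume j: "j \<in> I"
      show "?p (e j) [^]\<^bsub>G Mod N\<^esub> ?q = (if j = i then ?p (e j) else \<one>\<^bsub>G Mod N\<^esub>)"
      proof (cases "j = i")
        case True
        have "Q.ord (?p (e i)) dvd r i" using per[OF i, of "r i"] Q.pow_eq_id[OF pe[OF i]] by simp
        \<comment> \<open>The congruence modulo \<open>r i\<close> passes to the order of the image
          of \<open>e i\<close>, a divisor of \<open>r i\<close>. Integer exponents allow it to be
          read as divisibility of a difference.\<close>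
        then have "[int ?q = int 1] (mod int (Q.ord (?p (e i))))"
          using s[OF i] by (meson cong_dvd_modulus_nat cong_int_iff)
        then have "?p (e i) [^]\<^bsub>G Mod N\<^esub> int ?q = ?p (e i) [^]\<^bsub>G Mod N\<^esub> int 1"
          using Q.int_pow_eq[OF pe[OF i]] by (metis cong_iff_dvd_diff cong_sym)
        then have "?p (e i) [^]\<^bsub>G Mod N\<^esub> ?q = ?p (e i) [^]\<^bsub>G Mod N\<^esub> (1::nat)"
          unfolding int_pow_int .
        then show ?thesis using True Q.nat_pow_eone[OF pe[OF i]] by simp
      next
        case False
        then have "r j dvd ?q" using j I by (intro dvd_mult2) auto
        then show ?thesis using False per[OF j] by simp
      qed
    qed (use pe Q.one_closed in auto)
    also have "\<dots> = ?p (e i)"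
      using i I pe by (intro Q.finprod_singleton_swap) auto
    finally show "e i \<otimes> inv (f [^] ?q) \<in> N" using f e[OF i] by (simp flip: N.rcos_eq_iff)
  qed
qed

text \<open>All lifts \<open>e i\<close> are powers of one element \<open>f\<close> modulo \<open>L\<close>; hence the element \<open>z\<close> of \<open>K\<close> that
  agrees with \<open>f [^] P\<close> modulo \<open>L\<close> commutes with each \<open>e i\<close> up to a central factor, and this factor
  is killed by the coprime exponents \<open>s i\<close> and \<open>r i\<close>.\<close>

lemma lift_powers_commute:
  fixes r s q :: "'i \<Rightarrow> nat"
  assumes K: "K \<lhd> G" and L: "L \<lhd> G"
    and KL: "\<And>k l. k \<in> K \<Longrightarrow> l \<in> L \<Longrightarrow> k \<otimes> l = l \<otimes> k"
    and central: "\<And>a g. a \<in> K \<inter> L \<Longrightarrow> g \<in> carrier G \<Longrightarrow> a \<otimes> g = g \<otimes> a"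
    and f: "f \<in> carrier G" "f [^] P \<in> K <#> L"
    and e: "\<And>i. i \<in> I \<Longrightarrow> e i \<in> carrier G"
    and eK: "\<And>i. i \<in> I \<Longrightarrow> e i [^] r i \<in> K"
    and eL: "\<And>i. i \<in> I \<Longrightarrow> e i \<otimes> inv (f [^] q i) \<in> L"
    and qr: "\<And>i. i \<in> I \<Longrightarrow> q i * r i = P * s i"
    and sr: "\<And>i. i \<in> I \<Longrightarrow> coprime (s i) (r i)"
    and ij: "i \<in> I" "j \<in> I"
  shows "e i [^] r i \<otimes> e j = e j \<otimes> e i [^] r i"
proof -
  interpret K: normal K G by fact
  interpret L: normal L G by fact
  interpret Q: group "G Mod L" by (rule L.factorgroup_is_group)
  let ?p = "\<lambda>a. L #> a"
  interpret p: group_hom G "G Mod L" ?p by (rule L.group_hom_Mod)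
  obtain z l where zl: "f [^] P = z \<otimes> l" "z \<in> K" "l \<in> L" using f(2) by (auto simp: set_mult_def)
  then have z: "z \<in> carrier G" by simp
  have "?p l = \<one>\<^bsub>G Mod L\<^esub>" using zl by (simp add: L.rcos_eq_self_iff)
  then have "?p (z \<otimes> l) = ?p z" using zl z Q.r_one[OF p.hom_closed[OF z]] by (simp add: p.hom_mult del: mult_FactGroup one_FactGroup)
  then have pz: "?p z = ?p (f [^] P)" by (simp add: zl(1))
  \<comment> \<open>The commutator [z,f] lies in \<open>K\<close> because \<open>z\<close> does, and
    in \<open>L\<close> because modulo \<open>L\<close> the element \<open>z\<close> is a power of
    \<open>f\<close>; so it is central.\<close>
  define a where "a = z \<otimes> f \<otimes> inv z \<otimes> inv f"
  have "?p z \<otimes>\<^bsub>G Mod L\<^esub> ?p f = ?p f \<otimes>\<^bsub>G Mod L\<^esub> ?p z"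
  proof -
    have "f [^] P \<otimes> f = f \<otimes> f [^] P" using f by (simp add: group_commutes_pow)
    then show ?thesis unfolding pz using f by (simp flip: p.hom_mult del: mult_FactGroup)
  qed
  then have "a \<in> L" unfolding a_def using z f by (simp add: L.rcos_commute_iff)
  moreover have "z \<otimes> (f \<otimes> inv z \<otimes> inv f) \<in> K" using zl f by (intro K.m_closed K.inv_op_closed2) auto
  ultimately have aKL: "a \<in> K \<inter> L" using z f by (simp add: a_def m_assoc)
  then have ac: "a \<in> carrier G" by simp
  have zf: "z \<otimes> f = a \<otimes> (f \<otimes> z)" using z f by (simp add: a_def m_assoc)
  \<comment> \<open>Modulo \<open>L\<close> the \<open>r i\<close>-th power of \<open>e i\<close>
    is, by \<open>qr\<close>, the \<open>s i\<close>-th power of f^P, that is, of \<open>z\<close>.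
    Both elements also lie in \<open>K\<close>.\<close>
  have ez: "e i [^] r i \<otimes> inv (z [^] s i) \<in> K \<inter> L" if i: "i \<in> I" for i
  proof -
    have "?p (e i) = ?p (f [^] q i)" using eL[OF i] e[OF i] f by (simp add: L.rcos_eq_iff)
    then have "?p (e i [^] r i) = ?p ((f [^] q i) [^] r i)" using e[OF i] f by (simp add: p.hom_nat_pow)
    also have "(f [^] q i) [^] r i = (f [^] P) [^] s i" using f qr[OF i] by (simp add: nat_pow_pow)
    also have "?p ((f [^] P) [^] s i) = ?p (z [^] s i)" using f z pz by (simp add: p.hom_nat_pow)
    finally have "e i [^] r i \<otimes> inv (z [^] s i) \<in> L" using e[OF i] z by (simp add: L.rcos_eq_iff)
    moreover have "z [^] s i \<in> K" by (rule subgroup_nat_pow_closed[OF K.subgroup_axioms zl(2)])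
    ultimately show ?thesis using eK[OF i] by simp
  qed
  have ze: "z \<otimes> e j = e j \<otimes> z" if j: "j \<in> I" for j
  proof -
    define m where "m = e j \<otimes> inv (f [^] q j)"
    have m: "m \<in> L" "m \<in> carrier G" using eL[OF j] e[OF j] f by (simp_all add: m_def)
    have em: "e j = m \<otimes> f [^] q j" using e[OF j] f by (simp add: m_def m_assoc)
    have aq: "a [^] q j \<in> K \<inter> L"
      using aKL subgroup_nat_pow_closed[OF K.subgroup_axioms] subgroup_nat_pow_closed[OF L.subgroup_axioms] by blast
    define b where "b = e j [^] r j \<otimes> inv (z [^] s j)"
    have b: "b \<in> K \<inter> L" "b \<in> carrier G" using ez[OF j] by (simp_all add: b_def)
    have eb: "e j [^] r j = b \<otimes> z [^] s j" using e[OF j] z by (simp add: b_def m_assoc)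
    \<comment> \<open>\<open>z\<close> passes the \<open>L\<close>-part \<open>m\<close> of
      \<open>e j\<close> freely by \<open>KL\<close>; passing the power of \<open>f\<close> costs
      the central factor \<open>a [^] q j\<close>.\<close>
    have "z \<otimes> e j = (z \<otimes> m) \<otimes> f [^] q j" using z m f em by (simp add: m_assoc)
    also have "\<dots> = m \<otimes> (z \<otimes> f [^] q j)" using z m f KL[OF zl(2) m(1)] by (simp add: m_assoc)
    also have "\<dots> = m \<otimes> (a [^] q j \<otimes> (f [^] q j \<otimes> z))"
      using pow_commute_upto[OF z f(1) ac zf central[OF aKL f(1)]] by simp
    also have "\<dots> = (m \<otimes> a [^] q j) \<otimes> (f [^] q j \<otimes> z)" using m ac f z by (simp add: m_assoc)
    also have "m \<otimes> a [^] q j = a [^] q j \<otimes> m" using central[OF aq m(2)] by simp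
    also have "a [^] q j \<otimes> m \<otimes> (f [^] q j \<otimes> z) = a [^] q j \<otimes> (e j \<otimes> z)"
      using m ac f z em by (simp add: m_assoc)
    finally have zej: "z \<otimes> e j = a [^] q j \<otimes> (e j \<otimes> z)" .
    have bz: "b \<otimes> g = g \<otimes> b" if "g \<in> carrier G" for g using central[OF b(1) that] .
    show ?thesis
    \<comment> \<open>By \<open>eb\<close> the \<open>r j\<close>-th power of \<open>e j\<close> and
      the \<open>s j\<close>-th power of \<open>z\<close> differ by the central \<open>b\<close>. So
      the former commutes with \<open>z\<close> and the latter with \<open>e j\<close>.\<close>
    proof (rule commute_if_coprime_powers_commute[OF z e[OF j] _ zej _ _ _ _ sr[OF j]])
      show "a [^] q j \<in> carrier G" using ac by simp
      show "a [^] q j \<otimes> z = z \<otimes> a [^] q j" by (rule central[OF aq z])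
      show "a [^] q j \<otimes> e j = e j \<otimes> a [^] q j" by (rule central[OF aq e[OF j]])
      show "e j [^] r j \<otimes> z = z \<otimes> e j [^] r j"
      proof -
        have "z [^] s j \<otimes> z = z \<otimes> z [^] s j" using z by (simp add: group_commutes_pow)
        then show ?thesis using subgroup.m_closed[OF subgroup_centralizer[of "{z}"], of b "z [^] s j"] z b bz[OF z]
          by (simp add: eb)
      qed
      show "z [^] s j \<otimes> e j = e j \<otimes> z [^] s j"
      proof -
        have "z [^] s j = inv b \<otimes> e j [^] r j" using z b by (simp add: eb)
        moreover have "e j [^] r j \<otimes> e j = e j \<otimes> e j [^] r j" using e[OF j] by (simp add: group_commutes_pow)
        moreover have "inv b \<otimes> e j = e j \<otimes> inv b" using b e[OF j] bz by (intro inv_commute)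
        ultimately show ?thesis
          using subgroup.m_closed[OF subgroup_centralizer[of "{e j}"], of "inv b" "e j [^] r j"] e[OF j] b by simp
      qed
    qed
  qed
  \<comment> \<open>The same \<open>z\<close> serves all indices: the power of \<open>e i\<close> is
    a central element times a power of \<open>z\<close>, and \<open>z\<close> commutes with
    \<open>e j\<close>.\<close>
  define b where "b = e i [^] r i \<otimes> inv (z [^] s i)"
  have b: "b \<in> K \<inter> L" "b \<in> carrier G" using ez[OF ij(1)] by (simp_all add: b_def)
  have eb: "e i [^] r i = b \<otimes> z [^] s i" using e[OF ij(1)] z by (simp add: b_def m_assoc)
  have "z [^] s i \<otimes> e j = e j \<otimes> z [^] s i"
    using ze[OF ij(2)] z e[OF ij(2)] by (simp add: group_commutes_pow)
  then show ?thesis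
    using subgroup.m_closed[OF subgroup_centralizer[of "{e j}"], of b "z [^] s i"] e[OF ij(2)] b z
      central[OF b(1) e[OF ij(2)]] by (simp add: eb)
qed

end

section \<open>The relators of a free product of cyclic groups\<close>

lemma hom_eq_on_generate:
  assumes "group_hom G H f" "group_hom G H g" "S \<subseteq> carrier G"
    and "\<And>s. s \<in> S \<Longrightarrow> f s = g s" and "w \<in> generate G S"
  shows "f w = g w"
proof -
  interpret f: group_hom G H f by fact
  interpret g: group_hom G H g by fact
  show ?thesis
    using assms(5)
  proof induction
    case (eng h1 h2)
    then show ?case using assms(3) f.G.generate_in_carrier by simp
  qed (use assms(3,4) in auto)
qed

text \<open>The images \<open>z i\<close> of the relators commute with the whole image of
  \<open>\<phi>\<close>, so conjugation of a relator is invisible in \<open>E\<close>. An element of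
  the normal closure maps to a product of powers of the \<open>z i\<close> with exponents
  \<open>n i\<close>, while its exponent sum in \<open>x i\<close> is \<open>r i\<close> times
  \<open>n i\<close>. On the derived subgroup the exponent sums vanish, and \<open>r i\<close> > 0
  forces \<open>n i\<close> = 0.\<close>

lemma normal_closure_derived_subset_kernel:
  fixes r :: "nat \<Rightarrow> nat"
  assumes F: "free_basis F (x ` {..<t})" and inj: "inj_on x {..<t}"
    and r: "\<And>i. i < t \<Longrightarrow> r i > 0"
    and hom: "group_hom F E \<phi>"
    and comm: "\<And>i j. i < t \<Longrightarrow> j < t \<Longrightarrow>
      \<phi> (x i) [^]\<^bsub>E\<^esub> r i \<otimes>\<^bsub>E\<^esub> \<phi> (x j) = \<phi> (x j) \<otimes>\<^bsub>E\<^esub> \<phi> (x i) [^]\<^bsub>E\<^esub> r i"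
    and w: "w \<in> normal_closure F ((\<lambda>i. x i [^]\<^bsub>F\<^esub> r i) ` {..<t})"
    and w': "w \<in> comm_subgroup F (carrier F) (carrier F)"
  shows "\<phi> w = \<one>\<^bsub>E\<^esub>"
proof -
  interpret \<phi>: group_hom F E \<phi> by fact
  have B: "x ` {..<t} \<subseteq> carrier F" and gen: "generate F (x ` {..<t}) = carrier F"
    using F by (simp_all add: free_basis_def)
  have x: "x i \<in> carrier F" if "i < t" for i using B that by auto
  define z where "z i = \<phi> (x i) [^]\<^bsub>E\<^esub> r i" for i
  have zE: "z i \<in> carrier E" if "i < t" for i using x[OF that] by (simp add: z_def)
  have zc: "z i \<otimes>\<^bsub>E\<^esub> \<phi> g = \<phi> g \<otimes>\<^bsub>E\<^esub> z i" if i: "i < t" and g: "g \<in> carrier F" for i g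
  proof (rule \<phi>.H.generate_commute[of "{z i}" "\<phi> ` x ` {..<t}"])
    show "\<phi> g \<in> generate E (\<phi> ` x ` {..<t})"
      using \<phi>.generate_img[OF B] gen g by blast
    show "z i \<in> generate E {z i}" by (rule generate.incl) simp
  qed (use i comm x zE z_def in auto)
  define Z where "Z = generate E (z ` {..<t})"
  have zsub: "z ` {..<t} \<subseteq> carrier E" using zE by auto
  have Zsub: "subgroup Z E" unfolding Z_def by (rule \<phi>.H.generate_is_subgroup[OF zsub])
  \<comment> \<open>Restricting \<open>E\<close> to the abelian subgroup generated by the
    \<open>z i\<close> makes \<open>finprod\<close> available.\<close>
  define A where "A = E\<lparr>carrier := Z\<rparr>"
  have A [simp]: "carrier A = Z" "monoid.mult A = monoid.mult E" "one A = one E" by (simp_all add: A_def)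
  have zcomm: "z i \<otimes>\<^bsub>E\<^esub> z j = z j \<otimes>\<^bsub>E\<^esub> z i" if "i < t" "j < t" for i j
    using zc[OF that(1), of "x j [^]\<^bsub>F\<^esub> r j"] x[OF that(2)] by (simp add: z_def \<phi>.hom_nat_pow)
  have "group A" unfolding A_def by (rule \<phi>.H.subgroup_imp_group[OF Zsub])
  then interpret A: comm_group A
  proof (rule group.group_comm_groupI)
    fix a b assume "a \<in> carrier A" "b \<in> carrier A"
    then have ab: "a \<in> generate E (z ` {..<t})" "b \<in> generate E (z ` {..<t})"
      by (simp_all add: Z_def)
    have "a \<otimes>\<^bsub>E\<^esub> b = b \<otimes>\<^bsub>E\<^esub> a"
      by (rule \<phi>.H.generate_commute[OF zsub zsub _ ab]) (use zcomm in blast)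
    then show "a \<otimes>\<^bsub>A\<^esub> b = b \<otimes>\<^bsub>A\<^esub> a" by simp
  qed
  have zA: "z i \<in> carrier A" if "i < t" for i using that by (auto simp: Z_def intro: generate.incl)
  define \<beta> where "\<beta> n = finprod A (\<lambda>i. z i [^]\<^bsub>A\<^esub> (n i::int)) {..<t}" for n
  have \<beta>Z: "\<beta> n \<in> carrier A" for n
    unfolding \<beta>_def using zA by (intro A.finprod_closed) (auto simp del: A(1))
  have \<beta>0: "\<beta> n = \<one>\<^bsub>E\<^esub>" if "\<And>i. i < t \<Longrightarrow> n i = 0" for n
    unfolding \<beta>_def A(3)[symmetric] using that by (intro A.finprod_one_eqI) (auto simp del: A)
  have \<beta>add: "\<beta> (\<lambda>i. n i + m i) = \<beta> n \<otimes>\<^bsub>E\<^esub> \<beta> m" for n m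
  proof -
    have "\<beta> (\<lambda>i. n i + m i) = finprod A (\<lambda>i. z i [^]\<^bsub>A\<^esub> n i \<otimes>\<^bsub>A\<^esub> z i [^]\<^bsub>A\<^esub> m i) {..<t}"
      unfolding \<beta>_def using zA by (intro A.finprod_cong') (auto simp: A.int_pow_mult simp del: A)
    also have "\<dots> = \<beta> n \<otimes>\<^bsub>A\<^esub> \<beta> m"
      unfolding \<beta>_def using zA by (intro A.finprod_multf) (auto simp del: A)
    finally show ?thesis by simp
  qed
  have \<beta>single: "\<beta> (\<lambda>i. if i = j then 1 else 0) = z j" if "j < t" for j
  proof -
    have "\<beta> (\<lambda>i. if i = j then 1 else 0) = finprod A (\<lambda>i. if i = j then z i else \<one>\<^bsub>A\<^esub>) {..<t}"
      unfolding \<beta>_def using zA by (intro A.finprod_cong') (auto simp del: A)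
    also have "\<dots> = z j" using that zA by (intro A.finprod_singleton_swap) (auto simp del: A)
    finally show ?thesis .
  qed
  \<comment> \<open>\<open>\<epsilon>\<close> is the exponent sum in \<open>x i\<close>, obtained
    from the universal property; injectivity of \<open>x\<close> sends the other generators to
    0.\<close>
  have "\<exists>\<epsilon>. \<epsilon> \<in> hom F integer_group \<and> (\<forall>j<t. \<epsilon> (x j) = (if j = i then 1 else 0))" if "i < t" for i
  proof -
    obtain \<epsilon> where "\<epsilon> \<in> hom F integer_group" "\<And>b. b \<in> x ` {..<t} \<Longrightarrow> \<epsilon> b = (if b = x i then 1 else 0)"
      by (rule free_basis_extend_hom[OF F group_integer_group, of "\<lambda>b. if b = x i then 1 else 0"]) auto
    then show ?thesis using inj that by (intro exI[of _ \<epsilon>]) (auto simp: inj_on_def)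
  qed
  then obtain \<epsilon> where \<epsilon>: "\<And>i. i < t \<Longrightarrow> \<epsilon> i \<in> hom F integer_group"
    and \<epsilon>x: "\<And>i j. i < t \<Longrightarrow> j < t \<Longrightarrow> \<epsilon> i (x j) = (if j = i then 1 else 0)" by metis
  have \<epsilon>h: "group_hom F integer_group (\<epsilon> i)" if "i < t" for i
    using \<epsilon>[OF that] by (simp add: group_hom_def group_hom_axioms_def)
  \<comment> \<open>A single family \<open>n\<close> has to describe both the image in
    \<open>E\<close> and all exponent sums. Since such elements form a subgroup, only conjugates of
    relators need checking.\<close>
  let ?T = "{w \<in> carrier F. \<exists>n. \<phi> w = \<beta> n \<and> (\<forall>i<t. \<epsilon> i w = int (r i) * n i)}"
  have T: "subgroup ?T F"
  proof (rule \<phi>.G.subgroupI)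
    have "\<one>\<^bsub>F\<^esub> \<in> ?T"
      using \<beta>0[of "\<lambda>_. 0"] group_hom.hom_one[OF \<epsilon>h] by (auto intro!: exI[of _ "\<lambda>_. 0"])
    then show "?T \<noteq> {}" by blast
  next
    fix a assume "a \<in> ?T"
    then obtain n where a: "a \<in> carrier F" and n: "\<phi> a = \<beta> n" "\<And>i. i < t \<Longrightarrow> \<epsilon> i a = int (r i) * n i"
      by blast
    have "\<beta> (\<lambda>i. - n i) \<otimes>\<^bsub>E\<^esub> \<beta> n = \<one>\<^bsub>E\<^esub>" by (simp add: \<beta>0 flip: \<beta>add)
    moreover have "\<beta> m \<in> carrier E" for m using \<beta>Z[of m] subgroup.mem_carrier[OF Zsub] by simp
    ultimately have "\<phi> (inv\<^bsub>F\<^esub> a) = \<beta> (\<lambda>i. - n i)" using a n \<phi>.H.inv_equality by simp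
    moreover have "\<epsilon> i (inv\<^bsub>F\<^esub> a) = int (r i) * - n i" if "i < t" for i
      using group_hom.hom_inv[OF \<epsilon>h[OF that] a] n(2)[OF that] by simp
    ultimately show "inv\<^bsub>F\<^esub> a \<in> ?T" using a by blast
  next
    fix a b assume "a \<in> ?T" "b \<in> ?T"
    then obtain n m where a: "a \<in> carrier F" "\<phi> a = \<beta> n" "\<And>i. i < t \<Longrightarrow> \<epsilon> i a = int (r i) * n i"
      and b: "b \<in> carrier F" "\<phi> b = \<beta> m" "\<And>i. i < t \<Longrightarrow> \<epsilon> i b = int (r i) * m i" by blast
    have "\<phi> (a \<otimes>\<^bsub>F\<^esub> b) = \<beta> (\<lambda>i. n i + m i)" using a b by (simp add: \<beta>add)
    moreover have "\<epsilon> i (a \<otimes>\<^bsub>F\<^esub> b) = int (r i) * (n i + m i)" if "i < t" for i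
      using hom_mult[OF \<epsilon>[OF that] a(1) b(1)] a b that by (simp add: algebra_simps)
    ultimately show "a \<otimes>\<^bsub>F\<^esub> b \<in> ?T" using a b
      by (auto intro!: exI[of _ "\<lambda>i. n i + m i"])
  qed auto
  have "normal_closure F ((\<lambda>i. x i [^]\<^bsub>F\<^esub> r i) ` {..<t}) \<subseteq> ?T"
    unfolding normal_closure_def
  proof (rule \<phi>.G.generate_subgroup_incl[OF _ T], clarsimp)
    fix g j assume g: "g \<in> carrier F" and j: "j < t"
    let ?u = "g \<otimes>\<^bsub>F\<^esub> x j [^]\<^bsub>F\<^esub> r j \<otimes>\<^bsub>F\<^esub> inv\<^bsub>F\<^esub> g"
    have "\<phi> ?u = (\<phi> g \<otimes>\<^bsub>E\<^esub> z j) \<otimes>\<^bsub>E\<^esub> inv\<^bsub>E\<^esub> \<phi> g"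
      using g x[OF j] by (simp add: z_def \<phi>.hom_nat_pow)
    also have "\<dots> = z j" using g zE[OF j] by (simp add: \<phi>.H.m_assoc flip: zc[OF j g])
    finally have "\<phi> ?u = \<beta> (\<lambda>i. if i = j then 1 else 0)" using \<beta>single[OF j] by simp
    moreover have "\<epsilon> i ?u = int (r i) * (if i = j then 1 else 0)" if i: "i < t" for i
    proof -
      interpret \<epsilon>: group_hom F integer_group "\<epsilon> i" by (rule \<epsilon>h[OF i])
      show ?thesis using g x[OF j] \<epsilon>x[OF i j] by (simp add: \<epsilon>.hom_nat_pow)
    qed
    ultimately show "?u \<in> carrier F \<and> (\<exists>n. \<phi> ?u = \<beta> n \<and> (\<forall>i<t. \<epsilon> i ?u = int (r i) * n i))"
      using g x[OF j] by (intro conjI exI[of _ "\<lambda>i. if i = j then 1 else 0"]) auto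
  qed
  then obtain n where n: "\<phi> w = \<beta> n" "\<And>i. i < t \<Longrightarrow> \<epsilon> i w = int (r i) * n i" using w by blast
  have "\<epsilon> i w = 0" if i: "i < t" for i
  proof -
    interpret \<epsilon>: group_hom F integer_group "\<epsilon> i" by (rule \<epsilon>h[OF i])
    have "comm_subgroup F (carrier F) (carrier F) \<subseteq> kernel F integer_group (\<epsilon> i)"
      by (rule \<phi>.G.comm_subgroup_incl[OF \<epsilon>.subgroup_kernel]) (simp add: kernel_def)
    then show ?thesis using w' by (auto simp: kernel_def)
  qed
  then have "n i = 0" if "i < t" for i using n(2)[OF that] r[OF that] that by simp
  then show ?thesis using n(1) \<beta>0 by simp
qed

section \<open>The multiplier\<close>

text \<open>Here \<open>F\<close> is the free group on the \<open>t\<close> generators that present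
  the free product, and \<open>\<theta>\<close> is its projection onto \<open>G\<close>. The
  presentation whose multiplier is computed enters below as a separate group \<open>E\<close> over
  \<open>G\<close>.\<close>

locale coprime_cyclic_free_product =
  fixes F :: "('a, 'b) monoid_scheme" and x :: "nat \<Rightarrow> 'a" and r :: "nat \<Rightarrow> nat" and t :: nat
    and G :: "('g, 'h) monoid_scheme" and \<theta> :: "'a \<Rightarrow> 'g"
  assumes r_pos: "\<And>i. i < t \<Longrightarrow> r i > 0"
    and r_coprime: "\<And>i j. i < t \<Longrightarrow> j < t \<Longrightarrow> i \<noteq> j \<Longrightarrow> coprime (r i) (r j)"
    and free: "free_basis F (x ` {..<t})" and x_inj: "inj_on x {..<t}"
    and \<theta>_hom: "group_hom F G \<theta>" and \<theta>_surj: "\<theta> ` carrier F = carrier G"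
    and \<theta>_kernel: "kernel F G \<theta> = normal_closure F ((\<lambda>i. x i [^]\<^bsub>F\<^esub> r i) ` {..<t})"
begin

sublocale \<theta>: group_hom F G \<theta> by (rule \<theta>_hom)

lemma x_closed: "i < t \<Longrightarrow> x i \<in> carrier F"
  using free by (auto simp: free_basis_def)

lemma generate_x: "generate F (x ` {..<t}) = carrier F"
  using free by (simp add: free_basis_def)

lemma \<theta>_x_pow:
  assumes "i < t"
  shows "\<theta> (x i) [^]\<^bsub>G\<^esub> r i = \<one>\<^bsub>G\<^esub>"
proof -
  \<comment> \<open>The normal closure is generated by conjugates, so the relator is written as its
    conjugate by one.\<close>
  have "x i [^]\<^bsub>F\<^esub> r i = \<one>\<^bsub>F\<^esub> \<otimes>\<^bsub>F\<^esub> x i [^]\<^bsub>F\<^esub> r i \<otimes>\<^bsub>F\<^esub> inv\<^bsub>F\<^esub> \<one>\<^bsub>F\<^esub>"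
    using x_closed[OF assms] by simp
  then have "x i [^]\<^bsub>F\<^esub> r i \<in> kernel F G \<theta>"
    unfolding \<theta>_kernel normal_closure_def using assms by (intro generate.incl) blast
  then show ?thesis using x_closed[OF assms] by (simp add: kernel_def \<theta>.hom_nat_pow)
qed

text \<open>With c = Suc n and kernel K, this is the case where \<open>[K,_c E]\<close> is trivial
  and the intersection of K with L = gamma_(c+1)(E) is central. Lifts with mutually commuting
  \<open>r i\<close>-th powers and generators are constructed, L is realized by words in the derived
  subgroup of \<open>F\<close>, and \<open>normal_closure_derived_subset_kernel\<close>
  concludes.\<close>

lemma hypercentral_extension:
  fixes E :: "('e, 'f) monoid_scheme"
  assumes hom: "group_hom E G \<pi>" and surj: "\<pi> ` carrier E = carrier G"
    and nil: "iter_comm E (kernel E G \<pi>) (Suc n) = {\<one>\<^bsub>E\<^esub>}"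
    and central: "\<And>a g. a \<in> kernel E G \<pi> \<inter> iter_comm E (carrier E) (Suc n) \<Longrightarrow>
      g \<in> carrier E \<Longrightarrow> a \<otimes>\<^bsub>E\<^esub> g = g \<otimes>\<^bsub>E\<^esub> a"
  shows "kernel E G \<pi> \<inter> iter_comm E (carrier E) (Suc n) \<subseteq> {\<one>\<^bsub>E\<^esub>}"
proof -
  interpret \<pi>: group_hom E G \<pi> by fact
  let ?C = "iter_comm E (carrier E)"
  define K where "K = kernel E G \<pi>"
  define L where "L = ?C (Suc n)"
  note nil = nil[folded K_def] and central = central[folded K_def L_def]
  have K: "K \<lhd> E" unfolding K_def by (rule \<pi>.normal_kernel)
  have L: "L \<lhd> E" unfolding L_def by (intro \<pi>.G.iter_comm_normal \<pi>.G.carrier_normal)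
  have inK: "a \<in> K \<longleftrightarrow> \<pi> a = \<one>\<^bsub>G\<^esub>" if "a \<in> carrier E" for a
    using that by (simp add: K_def kernel_def)
  interpret K: normal K E by (rule K)
  interpret L: normal L E by (rule L)
  have diffK: "a \<otimes>\<^bsub>E\<^esub> inv\<^bsub>E\<^esub> b \<in> K" if "a \<in> carrier E" "b \<in> carrier E" "\<pi> a = \<pi> b" for a b
    using that by (simp add: inK)
  \<comment> \<open>Any choice of lifts of the generators extends to a homomorphism over
    \<open>G\<close>. This serves twice, for the first lifts \<open>e\<close> and for the corrected
    lifts \<open>b\<close>.\<close>
  have lift: "\<exists>\<phi>. group_hom F E \<phi> \<and> (\<forall>i<t. \<phi> (x i) = e i) \<and> (\<forall>w\<in>carrier F. \<pi> (\<phi> w) = \<theta> w)"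
    if e: "\<And>i. i < t \<Longrightarrow> e i \<in> carrier E" "\<And>i. i < t \<Longrightarrow> \<pi> (e i) = \<theta> (x i)" for e
  proof -
    obtain \<phi> where \<phi>: "\<phi> \<in> hom F E" "\<And>b. b \<in> x ` {..<t} \<Longrightarrow> \<phi> b = e (the_inv_into {..<t} x b)"
      using free_basis_extend_hom[OF free \<pi>.G.is_group, of "\<lambda>b. e (the_inv_into {..<t} x b)"] e(1)
        the_inv_into_into[OF x_inj _ subset_refl] by blast
    then have \<phi>x: "\<phi> (x i) = e i" if "i < t" for i
      using that by (simp add: the_inv_into_f_f[OF x_inj])
    have h: "group_hom F E \<phi>" using \<phi>(1) by (simp add: group_hom_def group_hom_axioms_def)
    have h': "group_hom F G (\<pi> \<circ> \<phi>)"
      using Group.hom_compose[OF \<phi>(1) \<pi>.homh] by (simp add: group_hom_def group_hom_axioms_def)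
    have "(\<pi> \<circ> \<phi>) w = \<theta> w" if "w \<in> carrier F" for w
    proof (rule hom_eq_on_generate[OF h' \<theta>.group_hom_axioms])
      show "w \<in> generate F (x ` {..<t})" using that generate_x by simp
      show "x ` {..<t} \<subseteq> carrier F" using x_closed by blast
      show "(\<pi> \<circ> \<phi>) s = \<theta> s" if "s \<in> x ` {..<t}" for s
        using that \<phi>x e(2) by auto
    qed
    with h \<phi>x show ?thesis by auto
  qed
  have "\<forall>i<t. \<exists>e\<in>carrier E. \<pi> e = \<theta> (x i)"
  proof (intro allI impI)
    fix i assume "i < t"
    then have "\<theta> (x i) \<in> \<pi> ` carrier E" using x_closed surj by simp
    then show "\<exists>e\<in>carrier E. \<pi> e = \<theta> (x i)" by force
  qed
  then obtain e where e: "\<And>i. i < t \<Longrightarrow> e i \<in> carrier E" "\<And>i. i < t \<Longrightarrow> \<pi> (e i) = \<theta> (x i)" by metis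
  have powK: "b [^]\<^bsub>E\<^esub> r i \<in> K" if "i < t" "b \<in> carrier E" "\<pi> b = \<theta> (x i)" for i b
    using that \<theta>_x_pow by (simp add: inK \<pi>.hom_nat_pow)
  have gen: "generate E (K \<union> e ` {..<t}) = carrier E"
  proof
    have sub: "K \<union> e ` {..<t} \<subseteq> carrier E" using e by auto
    then show "generate E (K \<union> e ` {..<t}) \<subseteq> carrier E" by (rule \<pi>.G.generate_incl)
    obtain \<phi> where \<phi>: "group_hom F E \<phi>" "\<And>i. i < t \<Longrightarrow> \<phi> (x i) = e i" "\<And>w. w \<in> carrier F \<Longrightarrow> \<pi> (\<phi> w) = \<theta> w"
      using lift[OF e] by blast
    interpret \<phi>: group_hom F E \<phi> by (rule \<phi>(1))
    show "carrier E \<subseteq> generate E (K \<union> e ` {..<t})"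
    proof
      fix g assume g: "g \<in> carrier E"
      then have "\<pi> g \<in> \<theta> ` carrier F" using \<theta>_surj by simp
      then obtain w where w: "w \<in> carrier F" "\<pi> g = \<theta> w" by blast
      have "\<phi> ` carrier F = generate E (\<phi> ` x ` {..<t})"
        using \<phi>.generate_img[of "x ` {..<t}"] x_closed generate_x by auto
      also have "\<phi> ` x ` {..<t} = e ` {..<t}" using \<phi>(2) by (auto simp: image_iff)
      finally have "\<phi> w \<in> generate E (e ` {..<t})" using w by blast
      then have "\<phi> w \<in> generate E (K \<union> e ` {..<t})"
        using \<pi>.G.mono_generate[of "e ` {..<t}" "K \<union> e ` {..<t}"] by blast
      moreover have "g \<otimes>\<^bsub>E\<^esub> inv\<^bsub>E\<^esub> \<phi> w \<in> generate E (K \<union> e ` {..<t})"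
        using g w \<phi>(3) by (intro generate.incl) (simp add: diffK)
      ultimately have "g \<otimes>\<^bsub>E\<^esub> inv\<^bsub>E\<^esub> \<phi> w \<otimes>\<^bsub>E\<^esub> \<phi> w \<in> generate E (K \<union> e ` {..<t})"
        by (rule generate.eng[rotated])
      then show "g \<in> generate E (K \<union> e ` {..<t})" using g w by (simp add: \<pi>.G.m_assoc)
    qed
  qed
  have one: "?C 1 \<subseteq> iter_comm E K 1 <#>\<^bsub>E\<^esub> ?C 2"
    using e powK r_coprime gen
    by (intro \<pi>.G.lcs_one_subset_of_coprime_generators[OF K, of "{..<t}" e r]) auto
  have perf: "comm_subgroup E L (carrier E) = L"
    using \<pi>.G.lcs_stabilizes[OF K one nil] by (simp add: L_def)
  have KL: "k \<otimes>\<^bsub>E\<^esub> l = l \<otimes>\<^bsub>E\<^esub> k" if "k \<in> K" "l \<in> L" for k l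
    by (rule \<pi>.G.hypercentral_commutes[OF K L perf nil central that])
  have N: "K <#>\<^bsub>E\<^esub> L \<lhd> E" by (rule \<pi>.G.set_mult_normal[OF K L])
  have ab: "comm_subgroup E (carrier E) (carrier E) \<subseteq> K <#>\<^bsub>E\<^esub> L"
    using \<pi>.G.lcs_one_subset[OF K one, of n] by (simp add: L_def)
  have KN: "K \<subseteq> K <#>\<^bsub>E\<^esub> L"
    by (rule \<pi>.G.set_mult_supset[OF K.subgroup_axioms L.subgroup_axioms])
  obtain f s where f: "f \<in> carrier E" "f [^]\<^bsub>E\<^esub> (\<Prod>i\<in>{..<t}. r i) \<in> K <#>\<^bsub>E\<^esub> L"
    and s: "\<And>i. i \<in> {..<t} \<Longrightarrow> coprime (s i) (r i)"
    and ef: "\<And>i. i \<in> {..<t} \<Longrightarrow>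
      e i \<otimes>\<^bsub>E\<^esub> inv\<^bsub>E\<^esub> (f [^]\<^bsub>E\<^esub> ((\<Prod>j\<in>{..<t}-{i}. r j) * s i)) \<in> K <#>\<^bsub>E\<^esub> L"
    using e powK r_coprime KN
    by (rule_tac \<pi>.G.crt_lift_abelian_quotient[OF N ab, of "{..<t}" e r]) auto
  define q where "q i = (\<Prod>j\<in>{..<t}-{i}. r j) * s i" for i
  \<comment> \<open>So far \<open>e i\<close> is a power of \<open>f\<close> only modulo KL.
    Dividing by the \<open>K\<close>-part gives another lift of \<open>\<theta> (x i)\<close> that
    is a power of \<open>f\<close> modulo \<open>L\<close> alone.\<close>
  have "\<forall>i<t. \<exists>b\<in>carrier E. \<pi> b = \<theta> (x i) \<and> b \<otimes>\<^bsub>E\<^esub> inv\<^bsub>E\<^esub> (f [^]\<^bsub>E\<^esub> q i) \<in> L"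
  proof (intro allI impI)
    fix i assume i: "i < t"
    then obtain k l where kl: "k \<in> K" "l \<in> L" "e i \<otimes>\<^bsub>E\<^esub> inv\<^bsub>E\<^esub> (f [^]\<^bsub>E\<^esub> q i) = k \<otimes>\<^bsub>E\<^esub> l"
      using ef[of i] by (auto simp: q_def set_mult_def)
    have "inv\<^bsub>E\<^esub> k \<otimes>\<^bsub>E\<^esub> e i \<otimes>\<^bsub>E\<^esub> inv\<^bsub>E\<^esub> (f [^]\<^bsub>E\<^esub> q i) = l"
      using kl e(1)[OF i] f by (simp add: \<pi>.G.m_assoc)
    moreover have "\<pi> (inv\<^bsub>E\<^esub> k \<otimes>\<^bsub>E\<^esub> e i) = \<theta> (x i)"
      using kl(1) e[OF i] inK[of k] x_closed[OF i] by simp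
    ultimately show "\<exists>b\<in>carrier E. \<pi> b = \<theta> (x i) \<and> b \<otimes>\<^bsub>E\<^esub> inv\<^bsub>E\<^esub> (f [^]\<^bsub>E\<^esub> q i) \<in> L"
      using kl e(1)[OF i] by (intro bexI[of _ "inv\<^bsub>E\<^esub> k \<otimes>\<^bsub>E\<^esub> e i"]) auto
  qed
  then obtain b where b: "\<And>i. i < t \<Longrightarrow> b i \<in> carrier E" "\<And>i. i < t \<Longrightarrow> \<pi> (b i) = \<theta> (x i)"
    and bL: "\<And>i. i < t \<Longrightarrow> b i \<otimes>\<^bsub>E\<^esub> inv\<^bsub>E\<^esub> (f [^]\<^bsub>E\<^esub> q i) \<in> L" by metis
  have bcomm: "b i [^]\<^bsub>E\<^esub> r i \<otimes>\<^bsub>E\<^esub> b j = b j \<otimes>\<^bsub>E\<^esub> b i [^]\<^bsub>E\<^esub> r i" if "i < t" "j < t" for i j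
  proof (rule \<pi>.G.lift_powers_commute[OF K L KL central f, of "{..<t}" b r q s])
    fix i assume "i \<in> {..<t}"
    then show "q i * r i = (\<Prod>i\<in>{..<t}. r i) * s i"
      by (simp add: q_def prod.remove[of "{..<t}" i] mult_ac)
  qed (use that b bL s powK in auto)
  obtain \<phi> where \<phi>: "group_hom F E \<phi>" "\<And>i. i < t \<Longrightarrow> \<phi> (x i) = b i" "\<And>w. w \<in> carrier F \<Longrightarrow> \<pi> (\<phi> w) = \<theta> w"
    using lift[OF b] by blast
  interpret \<phi>: group_hom F E \<phi> by (rule \<phi>(1))
  have CF: "iter_comm F (carrier F) m \<lhd> F" for m
    by (intro \<theta>.G.iter_comm_normal \<theta>.G.carrier_normal)
  have "\<phi> ` iter_comm F (carrier F) m \<subseteq> ?C m" for m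
  proof (induction m)
    case 0
    then show ?case by auto
  next
    case (Suc m)
    have "\<phi> ` iter_comm F (carrier F) (Suc m) = comm_subgroup E (\<phi> ` iter_comm F (carrier F) m) (\<phi> ` carrier F)"
      using subgroup.subset[OF normal_imp_subgroup[OF CF]] by (simp add: \<phi>.comm_subgroup_image)
    also have "\<dots> \<subseteq> ?C (Suc m)"
      using \<pi>.G.comm_subgroup_mono[OF Suc, of "\<phi> ` carrier F" "carrier E"] \<phi>.hom_closed
      by (simp add: image_subset_iff)
    finally show ?case .
  qed
  then have \<phi>L: "\<phi> w \<in> L" if "w \<in> iter_comm F (carrier F) (Suc n)" for w using that unfolding L_def by blast
  \<comment> \<open>Both surjections hit the same term of the series of \<open>G\<close>, so each
    element of \<open>L\<close> agrees modulo \<open>K\<close> with some \<open>\<phi> w\<close>,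
    where \<open>w\<close> lies in the corresponding term of \<open>F\<close>.\<close>
  have "\<pi> ` L = iter_comm G (carrier G) (Suc n)" "\<theta> ` iter_comm F (carrier F) (Suc n) = iter_comm G (carrier G) (Suc n)"
    using \<pi>.iter_comm_image[OF \<pi>.G.carrier_normal surj, of "Suc n"]
      \<theta>.iter_comm_image[OF \<theta>.G.carrier_normal \<theta>_surj, of "Suc n"] unfolding L_def surj \<theta>_surj by blast+
  then have L\<theta>: "\<pi> ` L = \<theta> ` iter_comm F (carrier F) (Suc n)" by simp
  have derived: "subgroup (comm_subgroup F (carrier F) (carrier F)) F"
    by (intro normal_imp_subgroup \<theta>.G.comm_subgroup_normal \<theta>.G.carrier_normal)
  \<comment> \<open>Since L = [L,E], commutators [l,g] suffice. In l = a \<open>\<phi> w\<close> the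
    factor \<open>a\<close> is in both \<open>K\<close> and \<open>L\<close>, hence central; in g =
    k \<open>\<phi> v\<close> the factor \<open>k\<close> is in \<open>K\<close>, hence centralizes
    \<open>L\<close>. Both drop out and leave the image of [w,v].\<close>
  have L\<phi>: "L \<subseteq> \<phi> ` comm_subgroup F (carrier F) (carrier F)"
  proof (subst perf[symmetric], rule \<pi>.G.comm_subgroup_incl)
    show "subgroup (\<phi> ` comm_subgroup F (carrier F) (carrier F)) E"
      by (rule \<phi>.subgroup_img_is_subgroup[OF derived])
    fix l g assume l: "l \<in> L" and g: "g \<in> carrier E"
    have "\<pi> l \<in> \<theta> ` iter_comm F (carrier F) (Suc n)" using L\<theta> l by blast
    then obtain w where wC: "w \<in> iter_comm F (carrier F) (Suc n)" and \<pi>l: "\<pi> l = \<theta> w" by blast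
    then have w: "w \<in> carrier F" using subgroup.mem_carrier[OF normal_imp_subgroup[OF CF]] by blast
    have "\<pi> g \<in> \<theta> ` carrier F" using g \<theta>_surj by simp
    then obtain v where v: "v \<in> carrier F" "\<pi> g = \<theta> v" by blast
    define a where "a = l \<otimes>\<^bsub>E\<^esub> inv\<^bsub>E\<^esub> \<phi> w"
    define k where "k = g \<otimes>\<^bsub>E\<^esub> inv\<^bsub>E\<^esub> \<phi> v"
    have kK: "k \<in> K" unfolding k_def using g v \<phi>(3) by (intro diffK) auto
    have "a \<in> K" unfolding a_def using l w \<pi>l \<phi>(3) by (intro diffK) auto
    moreover have "a \<in> L" unfolding a_def using l \<phi>L[OF wC] by simp
    ultimately have aKL: "a \<in> K \<inter> L" by simp
    have c: "a \<in> carrier E" "k \<in> carrier E" "\<phi> w \<in> carrier E" "\<phi> v \<in> carrier E" "l \<in> carrier E"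
      using aKL kK w v l by auto
    have la: "l = a \<otimes>\<^bsub>E\<^esub> \<phi> w" and gk: "g = k \<otimes>\<^bsub>E\<^esub> \<phi> v"
      using c g by (simp_all add: a_def k_def \<pi>.G.m_assoc)
    let ?c = "\<phi> w \<otimes>\<^bsub>E\<^esub> \<phi> v \<otimes>\<^bsub>E\<^esub> inv\<^bsub>E\<^esub> \<phi> w \<otimes>\<^bsub>E\<^esub> inv\<^bsub>E\<^esub> \<phi> v"
    have cL: "?c \<in> L"
      using \<pi>.G.commutator_in_comm_subgroup[OF \<phi>L[OF wC] c(4)] perf by simp
    have "l \<otimes>\<^bsub>E\<^esub> g \<otimes>\<^bsub>E\<^esub> inv\<^bsub>E\<^esub> l \<otimes>\<^bsub>E\<^esub> inv\<^bsub>E\<^esub> g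
        = a \<otimes>\<^bsub>E\<^esub> (\<phi> w \<otimes>\<^bsub>E\<^esub> g \<otimes>\<^bsub>E\<^esub> inv\<^bsub>E\<^esub> \<phi> w) \<otimes>\<^bsub>E\<^esub> inv\<^bsub>E\<^esub> a \<otimes>\<^bsub>E\<^esub> inv\<^bsub>E\<^esub> g"
      using c g unfolding la by (simp add: \<pi>.G.m_assoc \<pi>.G.inv_mult_group)
    also have "a \<otimes>\<^bsub>E\<^esub> (\<phi> w \<otimes>\<^bsub>E\<^esub> g \<otimes>\<^bsub>E\<^esub> inv\<^bsub>E\<^esub> \<phi> w) = (\<phi> w \<otimes>\<^bsub>E\<^esub> g \<otimes>\<^bsub>E\<^esub> inv\<^bsub>E\<^esub> \<phi> w) \<otimes>\<^bsub>E\<^esub> a"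
      using c g by (intro central[OF aKL]) auto
    also have "\<dots> \<otimes>\<^bsub>E\<^esub> inv\<^bsub>E\<^esub> a \<otimes>\<^bsub>E\<^esub> inv\<^bsub>E\<^esub> g = (\<phi> w \<otimes>\<^bsub>E\<^esub> k) \<otimes>\<^bsub>E\<^esub> \<phi> v \<otimes>\<^bsub>E\<^esub> inv\<^bsub>E\<^esub> \<phi> w \<otimes>\<^bsub>E\<^esub> inv\<^bsub>E\<^esub> \<phi> v \<otimes>\<^bsub>E\<^esub> inv\<^bsub>E\<^esub> k"
      using c unfolding gk by (simp add: \<pi>.G.m_assoc \<pi>.G.inv_mult_group)
    also have "\<phi> w \<otimes>\<^bsub>E\<^esub> k = k \<otimes>\<^bsub>E\<^esub> \<phi> w" using KL[OF kK \<phi>L[OF wC]] by simp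
    also have "k \<otimes>\<^bsub>E\<^esub> \<phi> w \<otimes>\<^bsub>E\<^esub> \<phi> v \<otimes>\<^bsub>E\<^esub> inv\<^bsub>E\<^esub> \<phi> w \<otimes>\<^bsub>E\<^esub> inv\<^bsub>E\<^esub> \<phi> v \<otimes>\<^bsub>E\<^esub> inv\<^bsub>E\<^esub> k = (k \<otimes>\<^bsub>E\<^esub> ?c) \<otimes>\<^bsub>E\<^esub> inv\<^bsub>E\<^esub> k"
      using c by (simp add: \<pi>.G.m_assoc)
    also have "k \<otimes>\<^bsub>E\<^esub> ?c = ?c \<otimes>\<^bsub>E\<^esub> k" by (rule KL[OF kK cL])
    also have "?c \<otimes>\<^bsub>E\<^esub> k \<otimes>\<^bsub>E\<^esub> inv\<^bsub>E\<^esub> k = ?c" using c by (simp add: \<pi>.G.m_assoc)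
    also have "?c = \<phi> (w \<otimes>\<^bsub>F\<^esub> v \<otimes>\<^bsub>F\<^esub> inv\<^bsub>F\<^esub> w \<otimes>\<^bsub>F\<^esub> inv\<^bsub>F\<^esub> v)" using w v by simp
    finally show "l \<otimes>\<^bsub>E\<^esub> g \<otimes>\<^bsub>E\<^esub> inv\<^bsub>E\<^esub> l \<otimes>\<^bsub>E\<^esub> inv\<^bsub>E\<^esub> g \<in> \<phi> ` comm_subgroup F (carrier F) (carrier F)"
      using \<theta>.G.commutator_in_comm_subgroup[OF w v(1)] by blast
  qed
  show ?thesis
  proof
    fix g assume "g \<in> kernel E G \<pi> \<inter> ?C (Suc n)"
    then have g: "g \<in> K" "g \<in> L" by (simp_all add: K_def L_def)
    then obtain w where w: "w \<in> comm_subgroup F (carrier F) (carrier F)" "g = \<phi> w" using L\<phi> by blast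
    then have wF: "w \<in> carrier F" using subgroup.mem_carrier[OF derived] by blast
    \<comment> \<open>As \<open>g\<close> lies in \<open>K\<close>, its preimage \<open>w\<close> is
      killed by \<open>\<theta>\<close>, so it belongs to the normal closure as well as to the
      derived subgroup.\<close>
    have "\<theta> w = \<one>\<^bsub>G\<^esub>" using g w wF \<phi>(3)[OF wF] by (simp add: inK)
    then have "w \<in> normal_closure F ((\<lambda>i. x i [^]\<^bsub>F\<^esub> r i) ` {..<t})"
      using wF by (simp add: kernel_def flip: \<theta>_kernel)
    then have "\<phi> w = \<one>\<^bsub>E\<^esub>"
      using bcomm \<phi>(2) w(1)
      by (intro normal_closure_derived_subset_kernel[OF free x_inj r_pos \<phi>.group_hom_axioms]) auto
    then show "g \<in> {\<one>\<^bsub>E\<^esub>}" using w by simp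
  qed
qed

text \<open>In the induction step \<open>W\<close> = \<open>iter_comm E R (Suc n)\<close> is divided
  out. The induction hypothesis, applied in \<open>E\<close> itself, puts the relevant intersection
  into \<open>iter_comm E R n\<close>, whose commutators with \<open>E\<close> lie in
  \<open>W\<close>. This is the centrality that \<open>hypercentral_extension\<close> asks of
  \<open>E Mod W\<close>.\<close>

lemma kernel_inter_lcs_subset:
  fixes E :: "('e, 'f) monoid_scheme"
  assumes hom: "group_hom E G \<pi>" and surj: "\<pi> ` carrier E = carrier G"
  shows "kernel E G \<pi> \<inter> iter_comm E (carrier E) n \<subseteq> iter_comm E (kernel E G \<pi>) n"
proof (induction n)
  case (Suc n)
  interpret \<pi>: group_hom E G \<pi> by fact
  define R where "R = kernel E G \<pi>"
  note IH = Suc[folded R_def]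
  have R: "R \<lhd> E" unfolding R_def by (rule \<pi>.normal_kernel)
  have inR: "a \<in> R \<longleftrightarrow> \<pi> a = \<one>\<^bsub>G\<^esub>" if "a \<in> carrier E" for a
    using that by (simp add: R_def kernel_def)
  interpret R: normal R E by (rule R)
  define W where "W = iter_comm E R (Suc n)"
  have W: "W \<lhd> E" unfolding W_def by (rule \<pi>.G.iter_comm_normal[OF R])
  interpret W: normal W E by (rule W)
  have WR: "W \<subseteq> R" unfolding W_def by (rule \<pi>.G.iter_comm_subset[OF R])
  let ?p = "\<lambda>a. W #>\<^bsub>E\<^esub> a"
  interpret p: group_hom E "E Mod W" ?p by (rule W.group_hom_Mod)
  obtain \<rho> where \<rho>: "\<rho> \<in> hom (E Mod W) G" "\<And>a. a \<in> carrier E \<Longrightarrow> \<rho> (?p a) = \<pi> a"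
  proof (rule FactGroup_universal[OF \<pi>.homh W])
    fix a b assume ab: "a \<in> carrier E" "b \<in> carrier E" "?p a = ?p b"
    then have "a \<otimes>\<^bsub>E\<^esub> inv\<^bsub>E\<^esub> b \<in> R" using WR by (auto simp: W.rcos_eq_iff)
    then have "\<pi> a \<otimes>\<^bsub>G\<^esub> inv\<^bsub>G\<^esub> \<pi> b = \<one>\<^bsub>G\<^esub>" using ab by (simp add: inR)
    then show "\<pi> a = \<pi> b" using ab \<theta>.H.inv_equality[of "\<pi> a" "inv\<^bsub>G\<^esub> \<pi> b"] by simp
  qed blast
  interpret \<rho>: group_hom "E Mod W" G \<rho>
    using \<rho>(1) by (simp add: group_hom_def group_hom_axioms_def W.factorgroup_is_group)
  have ker: "kernel (E Mod W) G \<rho> = ?p ` R"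
    using \<rho>(2) inR R.subset by (auto simp: kernel_def carrier_FactGroup)
  have psurj: "?p ` carrier E = carrier (E Mod W)" by (rule W.surj_Mod)
  have \<rho>surj: "\<rho> ` carrier (E Mod W) = carrier G"
    using surj \<rho>(2) by (simp add: image_image flip: psurj)
  have pR: "?p ` iter_comm E R m = iter_comm (E Mod W) (kernel (E Mod W) G \<rho>) m" for m
    unfolding ker by (rule p.iter_comm_image[OF R psurj])
  have pC: "?p ` iter_comm E (carrier E) m = iter_comm (E Mod W) (carrier (E Mod W)) m" for m
    using p.iter_comm_image[OF \<pi>.G.carrier_normal psurj, of m] by (simp add: psurj)
  \<comment> \<open>Because \<open>W\<close> lies inside the term of the series, a coset in the
    image of the term has all its representatives in the term.\<close>
  have inter: "a \<in> R \<inter> iter_comm E (carrier E) m"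
    if "a \<in> carrier E" "?p a \<in> kernel (E Mod W) G \<rho> \<inter> iter_comm (E Mod W) (carrier (E Mod W)) m"
      "W \<subseteq> iter_comm E (carrier E) m" for a m
  proof -
    have C: "subgroup (iter_comm E (carrier E) m) E"
      by (intro normal_imp_subgroup \<pi>.G.iter_comm_normal \<pi>.G.carrier_normal)
    have "?p a \<in> ?p ` iter_comm E (carrier E) m" using that(2) pC by blast
    then obtain d where d: "d \<in> iter_comm E (carrier E) m" "?p a = ?p d" by blast
    then have dE: "d \<in> carrier E" using subgroup.mem_carrier[OF C] by blast
    then have "a \<otimes>\<^bsub>E\<^esub> inv\<^bsub>E\<^esub> d \<in> iter_comm E (carrier E) m" using that d W.rcos_eq_iff by blast
    then have "a \<otimes>\<^bsub>E\<^esub> inv\<^bsub>E\<^esub> d \<otimes>\<^bsub>E\<^esub> d \<in> iter_comm E (carrier E) m"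
      using d subgroup.m_closed[OF C] by blast
    then have "a \<in> iter_comm E (carrier E) m" using that(1) dE by (simp add: \<pi>.G.m_assoc)
    moreover have "a \<in> R" using that(1,2) \<rho>(2) by (simp add: kernel_def inR)
    ultimately show ?thesis by simp
  qed
  have WC: "W \<subseteq> iter_comm E (carrier E) (Suc n)"
    unfolding W_def by (rule \<pi>.G.iter_comm_mono[OF R.subset])
  have nil: "iter_comm (E Mod W) (kernel (E Mod W) G \<rho>) (Suc n) = {\<one>\<^bsub>E Mod W\<^esub>}"
  proof -
    have "?p ` W = {W}" using image_constant[OF W.one_closed, of W] by (simp add: W.rcos_const cong: image_cong)
    then show ?thesis using pR[of "Suc n"] by (simp only: W_def[symmetric] one_FactGroup)
  qed
  have "kernel (E Mod W) G \<rho> \<inter> iter_comm (E Mod W) (carrier (E Mod W)) (Suc n) \<subseteq> {\<one>\<^bsub>E Mod W\<^esub>}"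
  proof (rule hypercentral_extension[OF \<rho>.group_hom_axioms \<rho>surj nil])
    fix A B assume A: "A \<in> kernel (E Mod W) G \<rho> \<inter> iter_comm (E Mod W) (carrier (E Mod W)) (Suc n)"
      and "B \<in> carrier (E Mod W)"
    then obtain a b where ab: "A = ?p a" "B = ?p b" "a \<in> carrier E" "b \<in> carrier E"
      by (auto simp: kernel_def carrier_FactGroup)
    then have "a \<in> R \<inter> iter_comm E (carrier E) (Suc n)" using inter[OF _ _ WC] A by blast
    then have "a \<in> iter_comm E R n"
      using IH \<pi>.G.iter_comm_Suc_subset[OF \<pi>.G.carrier_normal, of n] by blast
    then have "a \<otimes>\<^bsub>E\<^esub> b \<otimes>\<^bsub>E\<^esub> inv\<^bsub>E\<^esub> a \<otimes>\<^bsub>E\<^esub> inv\<^bsub>E\<^esub> b \<in> W"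
      unfolding W_def using ab by (simp add: \<pi>.G.commutator_in_comm_subgroup)
    then show "A \<otimes>\<^bsub>E Mod W\<^esub> B = B \<otimes>\<^bsub>E Mod W\<^esub> A" using ab by (simp add: W.rcos_commute_iff)
  qed
  then have triv: "?p ` R \<inter> ?p ` iter_comm E (carrier E) (Suc n) \<subseteq> {W}"
    by (simp only: ker pC one_FactGroup)
  show ?case
  proof
    fix a assume "a \<in> kernel E G \<pi> \<inter> iter_comm E (carrier E) (Suc n)"
    then have a: "a \<in> R \<inter> iter_comm E (carrier E) (Suc n)" by (simp only: R_def)
    then have "?p a = W" using triv by blast
    then have "a \<in> W" using a W.rcos_eq_self_iff by auto
    then show "a \<in> iter_comm E (kernel E G \<pi>) (Suc n)" by (simp only: W_def R_def)
  qed
qed simp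

end

lemma (in group) Mod_carrier_trivial: "trivial_group (G Mod carrier G)"
proof -
  interpret C: normal "carrier G" G by (rule carrier_normal)
  have "carrier (G Mod carrier G) = {carrier G}"
    using C.rcos_eq_self_iff by (force simp: carrier_FactGroup)
  then show ?thesis by (simp add: trivial_group_def C.factorgroup_is_group)
qed

text \<open>The free product is encoded, up to isomorphism, by its presentation over
  \<open>F0\<close>; \<open>\<pi>\<close> is the free presentation that defines the multiplier. The
  case \<open>t\<close> = 1 makes each summand of the direct sum trivial, so triviality also
  expresses the asserted isomorphism.\<close>

theorem theorem2p5:
  fixes F0 :: "('a, 'b) monoid_scheme" and x :: "nat \<Rightarrow> 'a"
    and r :: "nat \<Rightarrow> nat" and t c :: nat
    and G :: "('g, 'h) monoid_scheme"
    and F :: "('f, 'e) monoid_scheme" and \<pi> :: "'f \<Rightarrow> 'g"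
  assumes t: "t \<ge> 1"
    and r_pos: "\<forall>i<t. r i > 0"
    and r_coprime: "\<forall>i<t. \<forall>j<t. i \<noteq> j \<longrightarrow> gcd (r i) (r j) = 1"
    and F0_free: "free_basis F0 (x ` {..<t})" and x_inj: "inj_on x {..<t}"
    and G_grp: "group G"
    and G_freeprod: "G \<cong> F0 Mod normal_closure F0 ((\<lambda>i. x i [^]\<^bsub>F0\<^esub> r i) ` {..<t})"
    and c: "c \<ge> 1"
    and F_free: "free_group F"
    and \<pi>_hom: "\<pi> \<in> hom F G" and \<pi>_surj: "\<pi> ` carrier F = carrier G"
  shows "trivial_group (nilpotent_multiplier F (kernel F G \<pi>) c)"
proof -
  interpret F0: group F0 using F0_free by (simp add: free_basis_def)
  interpret G: group G by (rule G_grp)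
  interpret F: group F using F_free by (auto simp: free_group_def free_basis_def)
  define S where "S = normal_closure F0 ((\<lambda>i. x i [^]\<^bsub>F0\<^esub> r i) ` {..<t})"
  have x: "x i \<in> carrier F0" if "i < t" for i using F0_free that by (auto simp: free_basis_def)
  have "S \<lhd> F0"
    unfolding S_def normal_closure_def
  proof (rule F0.normal_generateI)
    show "(\<Union>g\<in>carrier F0. (\<lambda>s. g \<otimes>\<^bsub>F0\<^esub> s \<otimes>\<^bsub>F0\<^esub> inv\<^bsub>F0\<^esub> g) ` (\<lambda>i. x i [^]\<^bsub>F0\<^esub> r i) ` {..<t}) \<subseteq> carrier F0"
      using x by auto
  next
    fix h g assume "h \<in> (\<Union>g\<in>carrier F0. (\<lambda>s. g \<otimes>\<^bsub>F0\<^esub> s \<otimes>\<^bsub>F0\<^esub> inv\<^bsub>F0\<^esub> g) ` (\<lambda>i. x i [^]\<^bsub>F0\<^esub> r i) ` {..<t})"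
      and g: "g \<in> carrier F0"
    then obtain k i where k: "k \<in> carrier F0" and i: "i < t"
      and h: "h = k \<otimes>\<^bsub>F0\<^esub> x i [^]\<^bsub>F0\<^esub> r i \<otimes>\<^bsub>F0\<^esub> inv\<^bsub>F0\<^esub> k" by auto
    have "g \<otimes>\<^bsub>F0\<^esub> h \<otimes>\<^bsub>F0\<^esub> inv\<^bsub>F0\<^esub> g
        = (g \<otimes>\<^bsub>F0\<^esub> k) \<otimes>\<^bsub>F0\<^esub> x i [^]\<^bsub>F0\<^esub> r i \<otimes>\<^bsub>F0\<^esub> inv\<^bsub>F0\<^esub> (g \<otimes>\<^bsub>F0\<^esub> k)"
      using g k x[OF i] unfolding h by (simp add: F0.m_assoc F0.inv_mult_group)
    then show "g \<otimes>\<^bsub>F0\<^esub> h \<otimes>\<^bsub>F0\<^esub> inv\<^bsub>F0\<^esub> g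
        \<in> (\<Union>g\<in>carrier F0. (\<lambda>s. g \<otimes>\<^bsub>F0\<^esub> s \<otimes>\<^bsub>F0\<^esub> inv\<^bsub>F0\<^esub> g) ` (\<lambda>i. x i [^]\<^bsub>F0\<^esub> r i) ` {..<t})"
      using g k i by blast
  qed
  then interpret S: normal S F0 .
  obtain \<iota> where \<iota>: "\<iota> \<in> iso (F0 Mod S) G"
    using group.iso_sym[OF G_grp G_freeprod] by (auto simp: is_iso_def S_def)
  define \<theta> where "\<theta> = (\<lambda>w. \<iota> (S #>\<^bsub>F0\<^esub> w))"
  interpret \<iota>: group_hom "F0 Mod S" G \<iota>
    using \<iota> by (simp add: group_hom_def group_hom_axioms_def iso_def S.factorgroup_is_group)
  have "\<theta> \<in> hom F0 G"
    using Group.hom_compose[OF S.r_coset_hom_Mod \<iota>.homh] by (simp add: \<theta>_def comp_def)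
  then have \<theta>: "group_hom F0 G \<theta>" by (simp add: group_hom_def group_hom_axioms_def)
  have \<theta>surj: "\<theta> ` carrier F0 = carrier G"
    using \<iota> S.surj_Mod by (auto simp: \<theta>_def iso_def bij_betw_def simp flip: image_image)
  have "\<theta> w = \<one>\<^bsub>G\<^esub> \<longleftrightarrow> w \<in> S" if "w \<in> carrier F0" for w
  proof -
    have "\<theta> w = \<one>\<^bsub>G\<^esub> \<longleftrightarrow> S #>\<^bsub>F0\<^esub> w = \<one>\<^bsub>F0 Mod S\<^esub>"
      using \<iota> that \<iota>.hom_one \<iota>.inj_on_one_iff by (auto simp: \<theta>_def iso_def bij_betw_def carrier_FactGroup)
    then show ?thesis using that by (simp add: S.rcos_eq_self_iff)
  qed
  then have \<theta>ker: "kernel F0 G \<theta> = S" by (auto simp: kernel_def)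
  interpret coprime_cyclic_free_product F0 x r t G \<theta>
    using r_pos r_coprime F0_free x_inj \<theta> \<theta>surj \<theta>ker
    by unfold_locales (auto simp: S_def coprime_iff_gcd_eq_1 group_hom_def group_hom_axioms_def)
  let ?R = "kernel F G \<pi>"
  have hom: "group_hom F G \<pi>" using \<pi>_hom by (simp add: group_hom_def group_hom_axioms_def)
  then have R: "?R \<lhd> F" by (rule group_hom.normal_kernel)
  \<comment> \<open>Numerator and denominator coincide. One inclusion is
    \<open>kernel_inter_lcs_subset\<close>; conversely, iterated commutators of \<open>?R\<close>
    stay in \<open>?R\<close> and, by monotonicity, in the lower central term.\<close>
  have "?R \<inter> gamma F (Suc c) = iter_comm F ?R c"
    using kernel_inter_lcs_subset[OF hom \<pi>_surj, of c] F.iter_comm_subset[OF R]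
      F.iter_comm_mono[of ?R "carrier F" c] subgroup.subset[OF normal_imp_subgroup[OF R]]
    unfolding F.gamma_Suc_eq_iter_comm by blast
  moreover have "group (F\<lparr>carrier := iter_comm F ?R c\<rparr>)"
    by (intro F.subgroup_imp_group normal_imp_subgroup F.iter_comm_normal R)
  ultimately show ?thesis
    using group.Mod_carrier_trivial[of "F\<lparr>carrier := iter_comm F ?R c\<rparr>"]
    unfolding nilpotent_multiplier_def by simp
qed

end
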